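(* Let $\mathfrak g$ be a classical Lie algebra over $\mathbb C$ and let $\mathfrak p\subset\mathfrak g$ be a nice standard parabolic subalgebra given by its sequence of block lengths. Let $S_1$ be the set of roots involved in the element $X_R$ constructed for $\mathfrak p$ (as described in the context). Then the elements of $S_1$ form a simple system of roots if and only if one of the following holds: (a) $\mathfrak g$ is of type $A_n$ or $C_n$; (b) $\mathfrak g$ is orthogonal and $\mathfrak p$ is not of the form ( * ).
   Context: **Setup.** $J_m$ is the $m\times m$ matrix with entries $1$ on the skew-diagonal and $0$ elsewhere. Realizations: $\mathfrak{sl}_{n+1}$ (type $A_n$) is the trace zero matrices; $\mathfrak{so}_N=\{A=(a_{ij}) : a_{N+1-j,N+1-i}=-a_{ij}\}$ (type $B_n$ for $N=2n+1$, $D_n$ for $N=2n$); $\mathfrak{sp}_{2n}$ (type $C_n$) is the symplectic Lie algebra of the form with matrix $\begin{bmatrix}0&J_n\\ -J_n&0\end{bmatrix}$. The Cartan subalgebra is the diagonal matrices in $\mathfrak g$, the Borel subalgebra the upper triangular matrices in $\mathfrak g$; roots are taken with respect to this Cartan subalgebra. A standard parabolic subalgebra $\mathfrak p$ is described by the sequence of block lengths of its standard Levi factor: $\mathfrak p$ is the set of block upper triangular matrices in $\mathfrak g$ for this sequence. For $\mathfrak{so}_{2n}$ the sequences $(\dots,1,1,\dots)$ and $(\dots,2,\dots)$ (two central blocks of length 1, resp. one central block of length 2) give the same parabolic, and the second description is always used. $\mathfrak g=\bigoplus_j\mathfrak g_j$, where $\mathfrak g_j$ is the set of matrices in $\mathfrak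 g$ supported on the $j$-th block (super)diagonal; $\mathfrak p=\bigoplus_{j\ge0}\mathfrak g_j$, $\mathfrak n=\bigoplus_{j>0}\mathfrak g_j$; $\mathfrak g_1$ consists of rectangles $R_{i,i+1}$ ($a_i\times a_{i+1}$) on the first block superdiagonal. $\mathfrak p$ is nice if there is $X\in\mathfrak g_1$ with $[\mathfrak p,X]=\mathfrak n$. **Block sequences.** For $\mathfrak{sl}_{n+1}$: $(a_1,\dots,a_{r+1})$. For $\mathfrak{so}_N$, $\mathfrak{sp}_{2n}$: case (A) $(a_1,\dots,a_r,a_r,\dots,a_1)$ or case (B) $(a_1,\dots,a_r,a_{r+1},a_r,\dots,a_1)$. Unimodal means first weakly increasing, then weakly decreasing. By the known classification, if $\mathfrak p$ is nice then the sequence is unimodal, or $\mathfrak g$ is orthogonal and $a_1\le\dots\le a_l>a_{l+1}=\dots=a_r$ (case (A)), resp. $a_1\le\dots\le a_l>a_{l+1}=\dots=a_{r+1}$ (case (B)), with $a_l=a_{l+1}+1$. Put $B_i=\lceil a_i/2\rceil$, $b_i=\lfloor a_i/2\rfloor$. **Construction of $X_R$.** The displayed $J$'s sit in the indicated corners of the rectangle and all other entries are zero. *Type A.* For $1\le i\le r$: if $a_i\le a_{i+1}$, $R_{i,i+1}=\begin{bmatrix}J_{a_i}&0\end{bmatrix}$ ($i$ odd), $\begin{bmatrix}0&J_{a_i}\end{bmatrix}$ ($i$ even); if $a_i>a_{i+1}$, $R_{i,i+1}=\begin{bmatrix}0\\ J_{a_{i+1}}\end{bmatrix}$ ($i$ odd),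 $\begin{bmatrix}J_{a_{i+1}}\\ 0\end{bmatrix}$ ($i$ even). *Type C, case (A).* For $i\le r-1$, $R_{i,i+1}=\begin{bmatrix}J_{a_i}&0\end{bmatrix}$ ($i$ odd), $\begin{bmatrix}0&J_{a_i}\end{bmatrix}$ ($i$ even); the central $a_r\times a_r$ square on the block superdiagonal is $R_r=J_{a_r}$. *Type C, case (B).* For $i\le r$, $R_{i,i+1}$ has $J_{b_i}$ in its upper right and $J_{B_i}$ in its lower left corner if $i$ is odd; $J_{B_i}$ in its upper right and $J_{b_i}$ in its lower left corner if $i$ is even. *Types B, D, case (A).* For $i\le r-1$ the same rectangles $R_{i,i+1}$ as in type A. The central $a_r\times a_r$ square $R_r$ has $b_r$ blocks $\begin{bmatrix}1&0\\ 0&-1\end{bmatrix}$ along the skew-diagonal, the $k$-th one ($1\le k\le b_r$) in rows $a_r+1-2k,a_r+2-2k$ and columns $2k-1,2k$ if $r$ is odd, and in rows $2k-1,2k$ and columns $a_r+1-2k,a_r+2-2k$ if $r$ is even. *Types B, D, case (B).* For $i\le r$: - $a_i,a_{i+1}$ of the same parity: $R_{i,i+1}=\begin{bmatrix}0&J_{a_i}&0\end{bmatrix}$ with $(a_{i+1}-a_i)/2$ zero columns on each side; - $a_i=a_{i+1}+1$, $a_i$ even: $J_{B_i-1}$ in the upper right and $J_{B_i}$ in the lower left corner if $i$ is odd; $J_{B_i}$ in the upper right and $J_{B_i-1}$ in the lower left corner if $i$ is even (one zero row between them); - all other cases: $J_{B_i}$ in the upper right and $J_{B_i}$ in the lower left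 corner (entries $1$ at $(p,a_{i+1}+1-p)$ and at $(a_i+1-p,p)$ for $1\le p\le B_i$). Exception: for $\mathfrak g=\mathfrak{so}_{2n+1}$ with $a_l>a_{l+1}$, $a_{l-1}$ odd and $a_{l-1}=a_{l+1}$, the rectangle $R_{l-1,l}$ is instead the one with $J_{b_{l-1}}$ in the upper right and $J_{B_{l-1}}$ in the lower left corner if $l-1$ is odd, and with $J_{B_{l-1}}$ in the upper right and $J_{b_{l-1}}$ in the lower left corner if $l-1$ is even. In types B, C, D, $X_R\in\mathfrak g_1$ has the given rectangles in the upper left half of the block superdiagonal, $R_r$ in the central position in case (A), and the lower right half is determined by $X_R\in\mathfrak g$. **Roots.** $S_1$ is the set of roots $\alpha$ of $\mathfrak g$ such that $X_R$ has a nonzero component in the root space $\mathfrak g_\alpha$. A set of (positive) roots forms a simple system of roots if no difference of two of its elements is a root, i.e. the set is a base of the root subsystem it generates. **Form ( * ).** A nice parabolic subalgebra $\mathfrak p\subset\mathfrak{so}_N$ with an odd number of blocks $(a_1,\dots,a_r,a_{r+1},a_r,\dots,a_1)$ is of the form ( * ) if one of these holds: (1) the sequence is unimodal and there is $i<r$ with $a_i$ odd and $a_{i+1}$ even; (2) $a_l>a_{l+1}$ for some $l$, and there is $i<l$ with $a_i$ odd, $a_{i+1}$ even, where if $i=l-1$ then moreover $a_{l-1}<a_{l+1}$; (3) $a_l>a_{l+1}$ for some $l$, and $a_l$ is odd. Parabolics with an even number of blocks are not of the form ( * ). *)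

theory Defs
  imports Complex_Main "Jordan_Normal_Form.Matrix"
begin

section \<open>Classical Lie algebras as matrix Lie algebras\<close>

text \<open>Matrix entries are indexed from 0 (as in \<^theory>\<open>Jordan_Normal_Form.Matrix\<close>), so the
  transposed position with respect to the skew-diagonal of \<open>(i, j)\<close> is \<open>(N - 1 - j, N - 1 - i)\<close>.\<close>

datatype classical = TypeA nat | TypeB nat | TypeC nat | TypeD nat

fun lie_rank :: "classical \<Rightarrow> nat" where
  "lie_rank (TypeA n) = n"
| "lie_rank (TypeB n) = n"
| "lie_rank (TypeC n) = n"
| "lie_rank (TypeD n) = n"

fun msize :: "classical \<Rightarrow> nat" where
  "msize (TypeA n) = n + 1"
| "msize (TypeB n) = 2 * n + 1"
| "msize (TypeC n) = 2 * n"
| "msize (TypeD n) = 2 * n"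

fun orthogonal_type :: "classical \<Rightarrow> bool" where
  "orthogonal_type (TypeA n) = False"
| "orthogonal_type (TypeB n) = True"
| "orthogonal_type (TypeC n) = False"
| "orthogonal_type (TypeD n) = True"

definition J_mat :: "nat \<Rightarrow> complex mat" where
  "J_mat m = mat m m (\<lambda>(i, j). if i + j + 1 = m then 1 else 0)"

definition sl_alg :: "nat \<Rightarrow> complex mat set" where
  "sl_alg N = {A \<in> carrier_mat N N. (\<Sum>i<N. A $$ (i, i)) = 0}"

definition so_alg :: "nat \<Rightarrow> complex mat set" where
  "so_alg N = {A \<in> carrier_mat N N.
     \<forall>i<N. \<forall>j<N. A $$ (N - 1 - j, N - 1 - i) = - A $$ (i, j)}"

definition symplectic_form :: "nat \<Rightarrow> complex mat" where
  "symplectic_form n = four_block_mat (0\<^sub>m n n) (J_mat n) (- J_mat n) (0\<^sub>m n n)"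

definition sp_alg :: "nat \<Rightarrow> complex mat set" where
  "sp_alg n = {A \<in> carrier_mat (2 * n) (2 * n).
     transpose_mat A * symplectic_form n + symplectic_form n * A = 0\<^sub>m (2 * n) (2 * n)}"

fun lie_alg :: "classical \<Rightarrow> complex mat set" where
  "lie_alg (TypeA n) = sl_alg (n + 1)"
| "lie_alg (TypeB n) = so_alg (2 * n + 1)"
| "lie_alg (TypeC n) = sp_alg n"
| "lie_alg (TypeD n) = so_alg (2 * n)"

definition bracket :: "complex mat \<Rightarrow> complex mat \<Rightarrow> complex mat" where
  "bracket X Y = X * Y - Y * X"

definition cartan :: "classical \<Rightarrow> complex mat set" where
  "cartan T = {H \<in> lie_alg T. diagonal_mat H}"

definition borel :: "classical \<Rightarrow> complex mat set" where
  "borel T = {X \<in> lie_alg T. upper_triangular X}"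


section \<open>Roots\<close>

text \<open>A linear functional on the Cartan subalgebra is represented by a function on all matrices
  that vanishes outside the Cartan subalgebra. This makes the representation unique, and
  differences of functionals can be taken pointwise.\<close>

definition cartan_dual :: "classical \<Rightarrow> (complex mat \<Rightarrow> complex) set" where
  "cartan_dual T = {\<alpha>.
     (\<forall>H\<in>cartan T. \<forall>K\<in>cartan T. \<alpha> (H + K) = \<alpha> H + \<alpha> K) \<and>
     (\<forall>c. \<forall>H\<in>cartan T. \<alpha> (c \<cdot>\<^sub>m H) = c * \<alpha> H) \<and>
     (\<forall>H. H \<notin> cartan T \<longrightarrow> \<alpha> H = 0)}"

definition root_space :: "classical \<Rightarrow> (complex mat \<Rightarrow> complex) \<Rightarrow> complex mat set" where
  "root_space T \<alpha> = {X \<in> lie_alg T. \<forall>H\<in>cartan T. bracket H X = \<alpha> H \<cdot>\<^sub>m X}"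

definition roots :: "classical \<Rightarrow> (complex mat \<Rightarrow> complex) set" where
  "roots T = {\<alpha> \<in> cartan_dual T. \<alpha> \<noteq> (\<lambda>_. 0) \<and>
     (\<exists>X\<in>root_space T \<alpha>. X \<noteq> 0\<^sub>m (msize T) (msize T))}"

definition positive_roots :: "classical \<Rightarrow> (complex mat \<Rightarrow> complex) set" where
  "positive_roots T = {\<alpha> \<in> roots T. root_space T \<alpha> \<subseteq> borel T}"

definition simple_system :: "classical \<Rightarrow> (complex mat \<Rightarrow> complex) set \<Rightarrow> bool" where
  "simple_system T S \<longleftrightarrow> S \<subseteq> positive_roots T \<and>
     (\<forall>\<alpha>\<in>S. \<forall>\<beta>\<in>S. (\<lambda>H. \<alpha> H - \<beta> H) \<notin> roots T)"

text \<open>\<open>H\<close> and \<open>C\<close> below are the components of \<open>X\<close> in the root space decomposition. The sum of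
  matrices is written entrywise because matrices of varying size have no additive monoid
  structure as a type.\<close>

definition involved_roots :: "classical \<Rightarrow> complex mat \<Rightarrow> (complex mat \<Rightarrow> complex) set" where
  "involved_roots T X = {\<alpha> \<in> roots T. \<exists>H C.
     H \<in> cartan T \<and> (\<forall>\<beta>\<in>roots T. C \<beta> \<in> root_space T \<beta>) \<and>
     (\<forall>i<msize T. \<forall>j<msize T. X $$ (i, j) = H $$ (i, j) + (\<Sum>\<beta>\<in>roots T. C \<beta> $$ (i, j))) \<and>
     C \<alpha> \<noteq> 0\<^sub>m (msize T) (msize T)}"


section \<open>Standard parabolic subalgebras\<close>

text \<open>A sequence of block lengths is a list. Blocks are numbered from 1, since the parity of
  the number of a block matters in the construction below.\<close>

definition blen :: "nat list \<Rightarrow> nat \<Rightarrow> nat" where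
  "blen ds i = ds ! (i - 1)"

definition block_start :: "nat list \<Rightarrow> nat \<Rightarrow> nat" where
  "block_start ds i = sum_list (take (i - 1) ds)"

definition block_of :: "nat list \<Rightarrow> nat \<Rightarrow> nat" where
  "block_of ds p = (LEAST i. p < sum_list (take i ds))"

text \<open>In type D a central pair of blocks of length 1 is excluded in favour of a
  single central block of length 2, which gives the same parabolic subalgebra.\<close>

fun block_sequence :: "classical \<Rightarrow> nat list \<Rightarrow> bool" where
  "block_sequence (TypeA n) ds \<longleftrightarrow> 0 \<notin> set ds \<and> sum_list ds = n + 1"
| "block_sequence (TypeB n) ds \<longleftrightarrow> 0 \<notin> set ds \<and> sum_list ds = 2 * n + 1 \<and> rev ds = ds"
| "block_sequence (TypeC n) ds \<longleftrightarrow> 0 \<notin> set ds \<and> sum_list ds = 2 * n \<and> rev ds = ds"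
| "block_sequence (TypeD n) ds \<longleftrightarrow> 0 \<notin> set ds \<and> sum_list ds = 2 * n \<and> rev ds = ds \<and>
     \<not> (even (length ds) \<and> blen ds (length ds div 2) = 1)"

definition graded_part :: "classical \<Rightarrow> nat list \<Rightarrow> int \<Rightarrow> complex mat set" where
  "graded_part T ds j = {X \<in> lie_alg T. \<forall>p<msize T. \<forall>q<msize T.
     X $$ (p, q) \<noteq> 0 \<longrightarrow> int (block_of ds q) - int (block_of ds p) = j}"

definition parabolic :: "classical \<Rightarrow> nat list \<Rightarrow> complex mat set" where
  "parabolic T ds = {X \<in> lie_alg T. \<forall>p<msize T. \<forall>q<msize T.
     X $$ (p, q) \<noteq> 0 \<longrightarrow> block_of ds p \<le> block_of ds q}"

definition nilradical :: "classical \<Rightarrow> nat list \<Rightarrow> complex mat set" where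
  "nilradical T ds = {X \<in> lie_alg T. \<forall>p<msize T. \<forall>q<msize T.
     X $$ (p, q) \<noteq> 0 \<longrightarrow> block_of ds p < block_of ds q}"

definition nice :: "classical \<Rightarrow> nat list \<Rightarrow> bool" where
  "nice T ds \<longleftrightarrow> (\<exists>X\<in>graded_part T ds 1. (\<lambda>Y. bracket Y X) ` parabolic T ds = nilradical T ds)"


section \<open>The element \<open>X\<^sub>R\<close>\<close>

text \<open>\<open>J_at u v m\<close> is the set of positions, with rows and columns numbered from 1, of the
  entries 1 of a block \<open>J\<^sub>m\<close> that has \<open>u\<close> rows above it and \<open>v\<close> columns to its left.\<close>

definition J_at :: "nat \<Rightarrow> nat \<Rightarrow> nat \<Rightarrow> (nat \<times> nat) set" where
  "J_at u v m = {(u + p, v + (m + 1 - p)) | p. 1 \<le> p \<and> p \<le> m}"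

definition ones_mat :: "nat \<Rightarrow> nat \<Rightarrow> (nat \<times> nat) set \<Rightarrow> complex mat" where
  "ones_mat a b S = mat a b (\<lambda>(p, q). if (p + 1, q + 1) \<in> S then 1 else 0)"

definition corners :: "nat \<Rightarrow> nat \<Rightarrow> nat \<Rightarrow> nat \<Rightarrow> complex mat" where
  \<comment> \<open>\<open>J\<^sub>k\<close> in the upper right and \<open>J\<^sub>m\<close> in the lower left corner\<close>
  "corners a b k m = ones_mat a b (J_at 0 (b - k) k \<union> J_at (a - m) 0 m)"

definition half_up :: "nat \<Rightarrow> nat" where
  "half_up a = (a + 1) div 2"

definition rect_A :: "nat list \<Rightarrow> nat \<Rightarrow> complex mat" where
  "rect_A ds i = (let a = blen ds i; b = blen ds (i + 1) in
     if a \<le> b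
     then ones_mat a b (if odd i then J_at 0 0 a else J_at 0 (b - a) a)
     else ones_mat a b (if odd i then J_at (a - b) 0 b else J_at 0 0 b))"

definition rect_C :: "nat list \<Rightarrow> nat \<Rightarrow> complex mat" where
  "rect_C ds i = (let a = blen ds i; b = blen ds (i + 1); r = length ds div 2 in
     if even (length ds) then (if i < r then rect_A ds i else J_mat a)
     else if odd i then corners a b (a div 2) (half_up a)
     else corners a b (half_up a) (a div 2))"

text \<open>The case distinction on \<open>odd i\<close> is applied with \<open>i = r\<close>, the index of the central square.\<close>

definition central_square_BD :: "nat \<Rightarrow> nat \<Rightarrow> complex mat" where
  "central_square_BD i a = mat a a (\<lambda>(p, q).
     if \<exists>k\<in>{1..a div 2}. (p + 1, q + 1) =
          (if odd i then (a + 1 - 2 * k, 2 * k - 1) else (2 * k - 1, a + 1 - 2 * k)) then 1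
     else if \<exists>k\<in>{1..a div 2}. (p + 1, q + 1) =
          (if odd i then (a + 2 - 2 * k, 2 * k) else (2 * k, a + 2 - 2 * k)) then - 1
     else 0)"

text \<open>The first branch of the case of an odd number of blocks is the exceptional rectangle
  \<open>R\<^sub>l\<^sub>-\<^sub>1\<^sub>,\<^sub>l\<close> for odd matrix size, with \<open>l = i + 1\<close>.\<close>

definition rect_BD :: "nat list \<Rightarrow> nat \<Rightarrow> complex mat" where
  "rect_BD ds i = (let a = blen ds i; b = blen ds (i + 1); r = length ds div 2 in
     if even (length ds) then (if i < r then rect_A ds i else central_square_BD i a)
     else if odd (sum_list ds) \<and> i + 1 \<le> r \<and> b > blen ds (i + 2) \<and> odd a \<and> a = blen ds (i + 2)
     then (if odd i then corners a b (a div 2) (half_up a) else corners a b (half_up a) (a div 2))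
     else if even a \<longleftrightarrow> even b then ones_mat a b (J_at 0 ((b - a) div 2) a)
     else if a = b + 1 \<and> even a
     then (if odd i then corners a b (half_up a - 1) (half_up a)
           else corners a b (half_up a) (half_up a - 1))
     else corners a b (half_up a) (half_up a))"

fun rect :: "classical \<Rightarrow> nat list \<Rightarrow> nat \<Rightarrow> complex mat" where
  "rect (TypeA n) ds i = rect_A ds i"
| "rect (TypeB n) ds i = rect_BD ds i"
| "rect (TypeC n) ds i = rect_C ds i"
| "rect (TypeD n) ds i = rect_BD ds i"

text \<open>The rectangles that are prescribed are those with numbers 1 to \<open>num_rects T ds\<close>. For an even
  number of blocks in types B, C, D the last one is the central square.\<close>

fun num_rects :: "classical \<Rightarrow> nat list \<Rightarrow> nat" where
  "num_rects (TypeA n) ds = length ds - 1"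
| "num_rects (TypeB n) ds = length ds div 2"
| "num_rects (TypeC n) ds = length ds div 2"
| "num_rects (TypeD n) ds = length ds div 2"

definition rect_of :: "nat list \<Rightarrow> complex mat \<Rightarrow> nat \<Rightarrow> complex mat" where
  "rect_of ds X i = mat (blen ds i) (blen ds (i + 1))
     (\<lambda>(p, q). X $$ (block_start ds i + p, block_start ds (i + 1) + q))"

definition X_R :: "classical \<Rightarrow> nat list \<Rightarrow> complex mat" where
  "X_R T ds = (THE X. X \<in> graded_part T ds 1 \<and>
     (\<forall>i\<in>{1..num_rects T ds}. rect_of ds X i = rect T ds i))"

definition S1 :: "classical \<Rightarrow> nat list \<Rightarrow> (complex mat \<Rightarrow> complex) set" where
  "S1 T ds = involved_roots T (X_R T ds)"


section \<open>The form (*)\<close>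

definition unimodal :: "nat list \<Rightarrow> bool" where
  "unimodal ds \<longleftrightarrow> (\<exists>xs ys. ds = xs @ ys \<and> sorted xs \<and> sorted (rev ys))"

definition form_star :: "nat list \<Rightarrow> bool" where
  "form_star ds \<longleftrightarrow> odd (length ds) \<and> (let r = length ds div 2; a = blen ds in
     (unimodal ds \<and> (\<exists>i. 1 \<le> i \<and> i < r \<and> odd (a i) \<and> even (a (i + 1)))) \<or>
     (\<exists>l. 1 \<le> l \<and> l \<le> r \<and> a l > a (l + 1) \<and>
        (\<exists>i. 1 \<le> i \<and> i < l \<and> odd (a i) \<and> even (a (i + 1)) \<and>
           (i + 1 = l \<longrightarrow> a i < a (l + 1)))) \<or>
     (\<exists>l. 1 \<le> l \<and> l \<le> r \<and> a l > a (l + 1) \<and> odd (a l)))"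

end

theory Submission
  imports Defs "Jordan_Normal_Form.Determinant"
begin

text \<open>All roots are differences \<open>\<epsilon>\<^sub>i - \<epsilon>\<^sub>j\<close> of diagonal coordinates attached to matrix positions, and the
  roots involved in \<open>X\<close> are those of its nonzero off-diagonal entries. A difference of two roots of
  degree 1 is again a root only if, after reflecting one position in the skew-diagonal, the two
  entries share a row or a column. So \<open>S\<^sub>1\<close> is a simple system iff every row and column of every
  rectangle carries at most one nonzero entry, except that in the orthogonal case two entries of a
  row in the central block columns that are mirror images of each other (the roots
  \<open>\<epsilon>\<^sub>i \<plusminus> \<epsilon>\<^sub>j\<close>) do no harm.

  Niceness enters only through vectors \<open>v, w\<close> in the kernel of \<open>X\<close>: the rank-one or rank-two element
  of \<open>\<gg>\<close> built from them commutes with \<open>X\<close>, hence is orthogonal to \<open>[\<pp>, X]\<close>, and so it cannot have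
  negative degree. Applied to kernels that exist because two neighbouring blocks differ in length,
  this shows that the first half of the sequence increases, or, in the orthogonal case, drops at
  most once, by one, and is constant afterwards.\<close>

section \<open>Roots of the classical matrix Lie algebras\<close>

text \<open>The criterion can fail only at a rectangle from an odd a_i to an even a_{i+1}: its two
  corner blocks J have (a_i + 1)/2 rows each, so both meet the middle row. In the last rectangle the
  two entries of that row are mirror images and do no harm, unless a_i = a_{i+1} + 1, when the J's
  also share a column. The exceptional rectangle avoids the clash by shrinking one J. What remains
  must be matched with \<open>form_star\<close>; this uses that the parity of N is the parity of the
  central block, hence after a drop the parity of a_{l+1}. The classification of nice sequences is
  not assumed. The part of it that is needed is derived, and it is applied only for an odd number of
  blocks in types B, C, D. In type A, and for an even number of blocks, every rectangle has at most
  one nonzero entry per row and column whatever the lengths are.\<close>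

definition special_linear :: "classical \<Rightarrow> bool" where
  "special_linear T \<longleftrightarrow> (\<exists>n. T = TypeA n)"

definition opp :: "classical \<Rightarrow> nat \<Rightarrow> nat" where
  "opp T i = msize T - 1 - i"

text \<open>The sign in row \<open>i\<close> of the invariant form, whose only nonzero entry there
  is in column \<open>opp T i\<close>. It lets the symplectic and the orthogonal algebras share one
  reflection rule.\<close>

fun tau :: "classical \<Rightarrow> nat \<Rightarrow> complex" where
  "tau (TypeC n) i = (if i < n then 1 else - 1)"
| "tau _ i = 1"

lemma orthogonal_not_special_linear: "orthogonal_type T \<Longrightarrow> \<not> special_linear T"
  by (cases T) (auto simp: special_linear_def)

lemma opp_less [simp]: "i < msize T \<Longrightarrow> opp T i < msize T"
  by (auto simp: opp_def)

lemma opp_opp [simp]: "i < msize T \<Longrightarrow> opp T (opp T i) = i"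
  by (auto simp: opp_def)

lemma opp_eq_iff: "i < msize T \<Longrightarrow> j < msize T \<Longrightarrow> opp T i = j \<longleftrightarrow> i = opp T j"
  by (auto simp: opp_def)

lemma opp_inject [simp]: "i < msize T \<Longrightarrow> j < msize T \<Longrightarrow> opp T i = opp T j \<longleftrightarrow> i = j"
  by (auto simp: opp_def)

lemma tau_mult_self [simp]: "tau T i * tau T i = 1"
  by (cases T) auto

lemma tau_cases: "tau T i = 1 \<or> tau T i = - 1"
  by (cases T) auto

lemma tau_nonzero [simp]: "tau T i \<noteq> 0"
  using tau_cases[of T i] by auto

lemma tau_orthogonal: "orthogonal_type T \<Longrightarrow> tau T i = 1"
  by (cases T) auto

lemma tau_opp_symplectic:
  "\<not> special_linear T \<Longrightarrow> \<not> orthogonal_type T \<Longrightarrow> i < msize T \<Longrightarrow> tau T (opp T i) = - tau T i"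
  by (cases T) (auto simp: special_linear_def opp_def)

lemma tau_opp_mult:
  "i < msize T \<Longrightarrow> j < msize T \<Longrightarrow> tau T (opp T i) * tau T (opp T j) = tau T i * tau T j"
  by (cases T) (auto simp: opp_def)

section \<open>Membership in the Lie algebras, entry by entry\<close>

lemma symplectic_form_index:
  assumes "i < 2 * n" "j < 2 * n"
  shows "symplectic_form n $$ (i, j) = (if j = opp (TypeC n) i then tau (TypeC n) i else 0)"
  using assms by (auto simp: symplectic_form_def J_mat_def opp_def)

text \<open>Each row and column of the form matrix has one nonzero entry, so both products collapse
  to a single term. Replacing \<open>i\<close> by its mirror in the (i, j) entry of the equation
  gives the reflection rule of so, up to signs.\<close>

lemma sp_alg_iff:
  "A \<in> sp_alg n \<longleftrightarrow> A \<in> carrier_mat (2 * n) (2 * n) \<and>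
    (\<forall>i<2 * n. \<forall>j<2 * n.
      A $$ (opp (TypeC n) j, opp (TypeC n) i) = - tau (TypeC n) i * tau (TypeC n) j * A $$ (i, j))"
proof (cases "A \<in> carrier_mat (2 * n) (2 * n)")
  case A: True
  define ob t S where "ob = opp (TypeC n)" and "t = tau (TypeC n)" and "S = symplectic_form n"
  have o: "ob i < 2 * n" "ob (ob i) = i" "t (ob i) = - t i" "t i * t i = 1" if "i < 2 * n" for i
    using that opp_less[of i "TypeC n"] opp_opp[of i "TypeC n"] tau_opp_symplectic[of "TypeC n" i]
    by (simp_all add: ob_def t_def S_def special_linear_def del: tau.simps)
  have t: "t i = 1 \<or> t i = - 1" for i
    unfolding t_def by (rule tau_cases)
  have solve: "a = - x * y * b" if "a * - y + - x * b = 0" "y * y = 1" for a b x y :: complex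
  proof -
    have "- (a * y) = x * b" using that(1) by (simp add: add_eq_0_iff2)
    then have "a * y = - x * b" by (metis minus_minus mult_minus_left)
    then have "a * (y * y) = - x * y * b" by (metis mult.assoc mult.commute)
    then show ?thesis using that(2) by simp
  qed
  have S: "S \<in> carrier_mat (2 * n) (2 * n)"
    by (rule carrier_matI) (simp_all add: S_def symplectic_form_def J_mat_def)
  have Si: "S $$ (i, j) = (if j = ob i then t i else 0)" if "i < 2 * n" "j < 2 * n" for i j
    using symplectic_form_index[OF that] by (simp add: S_def ob_def t_def)
  have Si': "S $$ (i, j) = (if i = ob j then t i else 0)" if "i < 2 * n" "j < 2 * n" for i j
    using Si[OF that] o that by metis
  have l: "(transpose_mat A * S) $$ (i, j) = A $$ (ob j, i) * t (ob j)"
    if "i < 2 * n" "j < 2 * n" for i j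
  proof -
    have "(transpose_mat A * S) $$ (i, j) = (\<Sum>k<2 * n. A $$ (k, i) * S $$ (k, j))"
      using A S that by (simp add: scalar_prod_def atLeast0LessThan)
    also have "\<dots> = (\<Sum>k<2 * n. if k = ob j then A $$ (k, i) * t k else 0)"
      using that by (intro sum.cong) (simp_all add: Si')
    also have "\<dots> = A $$ (ob j, i) * t (ob j)"
      using that o(1) by (simp add: sum.delta)
    finally show ?thesis .
  qed
  have r: "(S * A) $$ (i, j) = t i * A $$ (ob i, j)" if "i < 2 * n" "j < 2 * n" for i j
  proof -
    have "(S * A) $$ (i, j) = (\<Sum>k<2 * n. S $$ (i, k) * A $$ (k, j))"
      using A S that by (simp add: scalar_prod_def atLeast0LessThan)
    also have "\<dots> = (\<Sum>k<2 * n. if k = ob i then t i * A $$ (k, j) else 0)"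
      using that by (intro sum.cong) (simp_all add: Si)
    also have "\<dots> = t i * A $$ (ob i, j)"
      using that o(1) by (simp add: sum.delta)
    finally show ?thesis .
  qed
  have "transpose_mat A * S + S * A = 0\<^sub>m (2 * n) (2 * n) \<longleftrightarrow>
      (\<forall>i<2 * n. \<forall>j<2 * n. (transpose_mat A * S) $$ (i, j) + (S * A) $$ (i, j) = 0)"
    using A S by (simp add: mat_eq_iff)
  also have "\<dots> \<longleftrightarrow> (\<forall>i<2 * n. \<forall>j<2 * n. A $$ (ob j, i) * t (ob j) + t i * A $$ (ob i, j) = 0)"
    by (simp add: l r)
  also have "\<dots> \<longleftrightarrow> (\<forall>i<2 * n. \<forall>j<2 * n. A $$ (ob j, ob i) = - t i * t j * A $$ (i, j))"
  proof (intro iffI allI impI)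
    fix i j assume h: "\<forall>i<2 * n. \<forall>j<2 * n. A $$ (ob j, i) * t (ob j) + t i * A $$ (ob i, j) = 0"
      and ij: "i < 2 * n" "j < 2 * n"
    have "A $$ (ob j, ob i) * - t j + - t i * A $$ (i, j) = 0"
      using h[rule_format, of "ob i" j] o[OF ij(1)] o[OF ij(2)] ij by simp
    then show "A $$ (ob j, ob i) = - t i * t j * A $$ (i, j)"
      using o(4)[OF ij(2)] by (rule solve)
  next
    fix i j assume h: "\<forall>i<2 * n. \<forall>j<2 * n. A $$ (ob j, ob i) = - t i * t j * A $$ (i, j)"
      and ij: "i < 2 * n" "j < 2 * n"
    have "A $$ (ob j, i) = t i * t j * A $$ (ob i, j)"
      using h[rule_format, of "ob i" j] o[OF ij(1)] o[OF ij(2)] ij by simp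
    then show "A $$ (ob j, i) * t (ob j) + t i * A $$ (ob i, j) = 0"
      using t[of j] o[OF ij(2)] by auto
  qed
  finally show ?thesis using A by (simp add: sp_alg_def S_def ob_def t_def)
qed (simp add: sp_alg_def)

lemma lie_alg_carrier: "A \<in> lie_alg T \<Longrightarrow> A \<in> carrier_mat (msize T) (msize T)"
  by (cases T) (auto simp: sl_alg_def so_alg_def sp_alg_def)

lemma lie_alg_iff:
  assumes "\<not> special_linear T"
  shows "A \<in> lie_alg T \<longleftrightarrow> A \<in> carrier_mat (msize T) (msize T) \<and>
    (\<forall>i<msize T. \<forall>j<msize T. A $$ (opp T j, opp T i) = - tau T i * tau T j * A $$ (i, j))"
  using assms
  by (cases T) (auto simp: special_linear_def so_alg_def opp_def sp_alg_iff simp del: One_nat_def)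

lemma lie_alg_special_linear_iff:
  assumes "special_linear T"
  shows "A \<in> lie_alg T \<longleftrightarrow> A \<in> carrier_mat (msize T) (msize T) \<and> (\<Sum>i<msize T. A $$ (i, i)) = 0"
  using assms by (auto simp: special_linear_def sl_alg_def simp del: sum.lessThan_Suc)

lemma lie_alg_flip:
  assumes "\<not> special_linear T" "A \<in> lie_alg T" "i < msize T" "j < msize T"
  shows "A $$ (opp T j, opp T i) = - tau T i * tau T j * A $$ (i, j)"
  using assms lie_alg_iff by blast

lemma lie_alg_flip_nonzero:
  assumes "\<not> special_linear T" "A \<in> lie_alg T" "i < msize T" "j < msize T"
  shows "A $$ (opp T j, opp T i) \<noteq> 0 \<longleftrightarrow> A $$ (i, j) \<noteq> 0"
  using lie_alg_flip[OF assms] by simp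

lemma lie_alg_orthogonal_opp:
  assumes "orthogonal_type T" "A \<in> lie_alg T" "i < msize T"
  shows "A $$ (i, opp T i) = 0"
  using lie_alg_flip[OF orthogonal_not_special_linear[OF assms(1)] assms(2,3) opp_less[OF assms(3)]]
    assms by (simp add: tau_orthogonal)

lemma lie_alg_add: "A \<in> lie_alg T \<Longrightarrow> B \<in> lie_alg T \<Longrightarrow> A + B \<in> lie_alg T"
  by (cases "special_linear T")
    (auto simp: lie_alg_special_linear_iff lie_alg_iff sum.distrib algebra_simps)

lemma lie_alg_smult: "A \<in> lie_alg T \<Longrightarrow> c \<cdot>\<^sub>m A \<in> lie_alg T"
  by (cases "special_linear T")
    (auto simp: lie_alg_special_linear_iff lie_alg_iff simp flip: sum_distrib_left)

text \<open>Cuts a matrix into root components. A mask that is symmetric under reflection respects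
  the reflection rule; trace zero survives because the diagonal is kept or removed as a
  whole.\<close>

lemma lie_alg_mask:
  assumes "A \<in> lie_alg T"
    and "\<And>i j. \<lbrakk>\<not> special_linear T; i < msize T; j < msize T\<rbrakk> \<Longrightarrow> P (opp T j) (opp T i) \<longleftrightarrow> P i j"
    and "(\<forall>i. P i i) \<or> (\<forall>i. \<not> P i i)"
  shows "mat (msize T) (msize T) (\<lambda>(i, j). if P i j then A $$ (i, j) else 0) \<in> lie_alg T"
  using assms
  by (cases "special_linear T") (auto simp: lie_alg_special_linear_iff lie_alg_iff)

text \<open>E_{ij} completed by its mirror image. The order of the tests matters on the
  skew-diagonal, where a position is its own mirror image and receives the entry 1 only
  once.\<close>

definition root_vector :: "classical \<Rightarrow> nat \<Rightarrow> nat \<Rightarrow> complex mat" where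
  "root_vector T i j = mat (msize T) (msize T) (\<lambda>(p, q).
     if p = i \<and> q = j then 1
     else if \<not> special_linear T \<and> p = opp T j \<and> q = opp T i then - tau T i * tau T j else 0)"

text \<open>The off-diagonal positions at which some element of the algebra is nonzero. Orthogonal
  matrices vanish on the skew-diagonal, which removes the functionals 2 e_i from the roots.\<close>

definition root_pos :: "classical \<Rightarrow> nat \<Rightarrow> nat \<Rightarrow> bool" where
  "root_pos T i j \<longleftrightarrow> i < msize T \<and> j < msize T \<and> i \<noteq> j \<and> (orthogonal_type T \<longrightarrow> j \<noteq> opp T i)"

lemma root_vector_mem_lie_alg:
  assumes "root_pos T i j"
  shows "root_vector T i j \<in> lie_alg T"
proof (cases "special_linear T")
  case True
  then show ?thesis
    using assms by (auto simp: lie_alg_special_linear_iff root_vector_def root_pos_def intro!: sum.neutral)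
next
  case False
  have b: "i < msize T" "j < msize T" using assms by (auto simp: root_pos_def)
  define c where "c = - tau T i * tau T j"
  \<comment> \<open>Consistency at a self-mirrored position: these occur here only in the symplectic
    case, where \<open>tau\<close> changes sign under \<open>opp T\<close>.\<close>
  have c: "c = 1" if "opp T j = i"
  proof -
    have "\<not> orthogonal_type T" using assms that b by (auto simp: root_pos_def)
    then show ?thesis using tau_opp_symplectic[OF False, of j] that b by (simp add: c_def)
  qed
  have c': "- tau T (opp T j) * tau T (opp T i) * c = 1"
    using tau_opp_mult[OF b(2,1)] tau_cases[of T i] tau_cases[of T j] by (auto simp: c_def)
  have e: "root_vector T i j $$ (p, q) =
      (if p = i \<and> q = j then 1 else if p = opp T j \<and> q = opp T i then c else 0)"
    if "p < msize T" "q < msize T" for p q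
    using that False by (simp add: root_vector_def c_def cong: if_cong split del: if_split)
  have "root_vector T i j $$ (opp T q, opp T p) = - tau T p * tau T q * root_vector T i j $$ (p, q)"
    if pq: "p < msize T" "q < msize T" for p q
  proof -
    consider "p = i" "q = j" | "p = opp T j" "q = opp T i" "\<not> (p = i \<and> q = j)"
      | "\<not> (p = i \<and> q = j)" "\<not> (p = opp T j \<and> q = opp T i)" by blast
    then show ?thesis
    proof cases
      case 1
      then show ?thesis using b c by (simp add: e) (simp add: c_def)
    next
      case 2
      then have "root_vector T i j $$ (p, q) = c" "root_vector T i j $$ (opp T q, opp T p) = 1"
        using e[OF pq] e[OF b] b by (metis, simp)
      then show ?thesis using 2 c' by simp
    next
      case 3
      have "\<not> (opp T q = i \<and> opp T p = j)"
        using 3(2) opp_eq_iff[OF pq(1) b(2)] opp_eq_iff[OF pq(2) b(1)] by blast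
      moreover have "\<not> (opp T q = opp T j \<and> opp T p = opp T i)"
        using 3(1) opp_inject pq b by blast
      ultimately have "root_vector T i j $$ (opp T q, opp T p) = 0"
        by (simp only: e[OF opp_less[OF pq(2)] opp_less[OF pq(1)]] if_False)
      moreover have "root_vector T i j $$ (p, q) = 0"
        by (simp only: e[OF pq] 3 if_False)
      ultimately show ?thesis by simp
    qed
  qed
  moreover have "root_vector T i j \<in> carrier_mat (msize T) (msize T)" by (simp add: root_vector_def)
  ultimately show ?thesis using lie_alg_iff[OF False] by blast
qed

section \<open>Diagonal matrices, root spaces and the set of roots\<close>

definition diag_of :: "classical \<Rightarrow> (nat \<Rightarrow> complex) \<Rightarrow> complex mat" where
  "diag_of T x = mat (msize T) (msize T) (\<lambda>(i, j). if i = j then x i else 0)"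

lemma diag_of_index [simp]:
  "i < msize T \<Longrightarrow> j < msize T \<Longrightarrow> diag_of T x $$ (i, j) = (if i = j then x i else 0)"
  by (simp add: diag_of_def)

lemma diag_of_mem_cartan_special_linear:
  "special_linear T \<Longrightarrow> diag_of T x \<in> cartan T \<longleftrightarrow> (\<Sum>i<msize T. x i) = 0"
  by (auto simp: cartan_def lie_alg_special_linear_iff diagonal_mat_def diag_of_def)

lemma diag_of_mem_cartan:
  assumes "\<not> special_linear T"
  shows "diag_of T x \<in> cartan T \<longleftrightarrow> (\<forall>i<msize T. x (opp T i) = - x i)"
  unfolding cartan_def lie_alg_iff[OF assms] mem_Collect_eq
  by (auto simp: diagonal_mat_def diag_of_def)

lemma cartan_index: "H \<in> cartan T \<Longrightarrow> i < msize T \<Longrightarrow> j < msize T \<Longrightarrow> i \<noteq> j \<Longrightarrow> H $$ (i, j) = 0"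
  using lie_alg_carrier[of H T] by (auto simp: cartan_def diagonal_mat_def)

lemma cartan_carrier: "H \<in> cartan T \<Longrightarrow> H \<in> carrier_mat (msize T) (msize T)"
  using lie_alg_carrier by (auto simp: cartan_def)

lemma cartan_add: "H \<in> cartan T \<Longrightarrow> K \<in> cartan T \<Longrightarrow> H + K \<in> cartan T"
  using lie_alg_add[of H T K] cartan_carrier[of H T] cartan_carrier[of K T]
  by (auto simp: cartan_def diagonal_mat_def)

lemma cartan_smult: "H \<in> cartan T \<Longrightarrow> c \<cdot>\<^sub>m H \<in> cartan T"
  using lie_alg_smult[of H T c] cartan_carrier[of H T]
  by (auto simp: cartan_def diagonal_mat_def)

text \<open>The value 0 off the Cartan subalgebra is what \<open>cartan_dual\<close> demands; with
  it, equality of roots is equality of functions.\<close>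

definition root_at :: "classical \<Rightarrow> nat \<Rightarrow> nat \<Rightarrow> complex mat \<Rightarrow> complex" where
  "root_at T i j = (\<lambda>H. if H \<in> cartan T then H $$ (i, i) - H $$ (j, j) else 0)"

lemma root_at_cartan_dual: "i < msize T \<Longrightarrow> j < msize T \<Longrightarrow> root_at T i j \<in> cartan_dual T"
  using cartan_carrier
  by (auto simp: cartan_dual_def root_at_def cartan_add cartan_smult algebra_simps dest!: cartan_carrier)

lemma root_at_opp:
  assumes "\<not> special_linear T" "i < msize T" "j < msize T"
  shows "root_at T (opp T j) (opp T i) = root_at T i j"
  using lie_alg_flip[OF assms(1)] assms by (auto simp: root_at_def cartan_def)

lemma root_at_self [simp]: "root_at T i i = (\<lambda>_. 0)"
  by (auto simp: root_at_def)

lemma bracket_cartan_index: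
  assumes H: "H \<in> cartan T" and X: "X \<in> carrier_mat (msize T) (msize T)"
    and ij: "i < msize T" "j < msize T"
  shows "bracket H X $$ (i, j) = (H $$ (i, i) - H $$ (j, j)) * X $$ (i, j)"
proof -
  note Hc = cartan_carrier[OF H]
  have 1: "(H * X) $$ (i, j) = (\<Sum>k<msize T. if k = i then H $$ (i, i) * X $$ (i, j) else 0)"
    using Hc X ij cartan_index[OF H]
    by (auto simp: scalar_prod_def atLeast0LessThan simp del: sum.delta sum.delta' intro!: sum.cong)
  have 2: "(X * H) $$ (i, j) = (\<Sum>k<msize T. if k = j then X $$ (i, j) * H $$ (j, j) else 0)"
    using Hc X ij cartan_index[OF H]
    by (auto simp: scalar_prod_def atLeast0LessThan simp del: sum.delta sum.delta' intro!: sum.cong)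
  show ?thesis using 1 2 Hc X ij by (simp add: bracket_def algebra_simps)
qed

text \<open>ad H multiplies the entry (i, j) by H_ii - H_jj, so a common eigenvector can be nonzero
  only where this difference is \<open>\<alpha>\<close>. Off the Cartan subalgebra both functionals
  are 0.\<close>

lemma root_space_iff:
  assumes "\<alpha> \<in> cartan_dual T"
  shows "X \<in> root_space T \<alpha> \<longleftrightarrow> X \<in> lie_alg T \<and>
    (\<forall>i<msize T. \<forall>j<msize T. X $$ (i, j) \<noteq> 0 \<longrightarrow> \<alpha> = root_at T i j)"
proof (cases "X \<in> lie_alg T")
  case True
  note X = lie_alg_carrier[OF True]
  have "bracket H X = \<alpha> H \<cdot>\<^sub>m X \<longleftrightarrow>
      (\<forall>i<msize T. \<forall>j<msize T. X $$ (i, j) \<noteq> 0 \<longrightarrow> \<alpha> H = root_at T i j H)" if "H \<in> cartan T" for H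
  proof -
    have "bracket H X \<in> carrier_mat (msize T) (msize T)"
      using X cartan_carrier[OF that] by (auto simp: bracket_def)
    then show ?thesis
      using X that by (auto simp: mat_eq_iff bracket_cartan_index[OF that X] root_at_def) metis+
  qed
  moreover have "\<alpha> H = root_at T i j H" if "H \<notin> cartan T" for H i j
    using assms that by (auto simp: cartan_dual_def root_at_def)
  ultimately show ?thesis
    using True unfolding root_space_def fun_eq_iff mem_Collect_eq by metis
qed (simp add: root_space_def)

text \<open>The diagonal matrix of \<open>x i = m - 1 - 2 i\<close> is regular dominant: it separates the height.\<close>

lemma root_at_height:
  assumes "root_at T i j = root_at T p q" "i < msize T" "j < msize T" "p < msize T" "q < msize T"
  shows "int j - int i = int q - int p"
proof -
  define m where "m = msize T"
  define x :: "nat \<Rightarrow> complex" where "x i = of_int (int m - 1 - 2 * int i)" for i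
  \<comment> \<open>The trace is generalised to partial sums to allow induction; their value k (m -
    k) vanishes at k = m. As \<open>x\<close> is also antisymmetric under \<open>opp T\<close>, one
    matrix serves all types.\<close>
  have "(\<Sum>i<k. x i) = of_int (int k * (int m - int k))" for k
    by (induction k) (auto simp: x_def algebra_simps)
  then have "(\<Sum>i<m. x i) = 0" by simp
  moreover have "x (opp T i) = - x i" if "i < msize T" for i
    using that by (auto simp: x_def opp_def m_def of_nat_diff)
  ultimately have H: "diag_of T x \<in> cartan T"
    by (cases "special_linear T") (auto simp: diag_of_mem_cartan diag_of_mem_cartan_special_linear m_def)
  have "x i - x j = x p - x q"
    using fun_cong[OF assms(1), of "diag_of T x"] H assms by (simp add: root_at_def)
  then have "complex_of_int (2 * int j - 2 * int i) = of_int (2 * int q - 2 * int p)"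
    by (simp add: x_def algebra_simps)
  then have "2 * int j - 2 * int i = 2 * int q - 2 * int p" by (simp only: of_int_eq_iff)
  then show ?thesis by simp
qed

lemma root_at_nonzero:
  assumes "root_pos T i j"
  shows "root_at T i j \<noteq> (\<lambda>_. 0)"
  using root_at_height[of T i j i i] assms by (auto simp: root_pos_def)

lemma roots_eq: "roots T = {root_at T i j | i j. root_pos T i j}"
proof (intro equalityI subsetI)
  fix \<alpha> assume a: "\<alpha> \<in> roots T"
  then have ad: "\<alpha> \<in> cartan_dual T" and an: "\<alpha> \<noteq> (\<lambda>_. 0)" by (auto simp: roots_def)
  from a obtain X where X: "X \<in> root_space T \<alpha>" "X \<noteq> 0\<^sub>m (msize T) (msize T)"
    by (auto simp: roots_def)
  have Xl: "X \<in> lie_alg T" using X by (simp add: root_space_def)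
  obtain i j where ij: "i < msize T" "j < msize T" "X $$ (i, j) \<noteq> 0"
    using X(2) lie_alg_carrier[OF Xl] by (auto simp: mat_eq_iff)
  then have "\<alpha> = root_at T i j" using X(1) root_space_iff[OF ad] by blast
  moreover from this an have "i \<noteq> j" by auto
  then have "root_pos T i j"
    using ij lie_alg_orthogonal_opp[OF _ Xl] by (auto simp: root_pos_def)
  ultimately show "\<alpha> \<in> {root_at T i j | i j. root_pos T i j}" by blast
next
  fix \<alpha> assume "\<alpha> \<in> {root_at T i j | i j. root_pos T i j}"
  then obtain i j where a: "\<alpha> = root_at T i j" and ij: "root_pos T i j" by auto
  then have ij': "i < msize T" "j < msize T" by (auto simp: root_pos_def)
  have "root_vector T i j \<in> root_space T (root_at T i j)"
    using root_vector_mem_lie_alg[OF ij] ij' root_at_opp[of T i j]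
    by (auto simp: root_space_iff root_at_cartan_dual root_vector_def)
  moreover have "root_vector T i j $$ (i, j) \<noteq> 0" using ij' by (simp add: root_vector_def)
  then have "root_vector T i j \<noteq> 0\<^sub>m (msize T) (msize T)" using ij' by auto
  ultimately show "\<alpha> \<in> roots T"
    using a root_at_nonzero[OF ij] root_at_cartan_dual[OF ij'] by (auto simp: roots_def)
qed

lemma finite_roots: "finite (roots T)"
proof -
  have "roots T \<subseteq> (\<lambda>(i, j). root_at T i j) ` ({..<msize T} \<times> {..<msize T})"
    by (auto simp: roots_eq root_pos_def)
  then show ?thesis by (rule finite_subset) auto
qed

lemma root_at_mem_roots: "root_pos T i j \<Longrightarrow> root_at T i j \<in> roots T"
  by (auto simp: roots_eq)

lemma nonzero_entry_root_pos:
  "X \<in> lie_alg T \<Longrightarrow> i < msize T \<Longrightarrow> j < msize T \<Longrightarrow> i \<noteq> j \<Longrightarrow> X $$ (i, j) \<noteq> 0 \<Longrightarrow> root_pos T i j"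
  using lie_alg_orthogonal_opp by (auto simp: root_pos_def)

text \<open>Different root spaces have disjoint supports. So at a nonzero position of one component
  no other component contributes, and the entry of \<open>X\<close> there is that of the component.
  Conversely, grouping the entries of \<open>X\<close> by their root is a decomposition.\<close>

lemma involved_roots_eq:
  assumes X: "X \<in> lie_alg T"
  shows "involved_roots T X =
    {root_at T i j | i j. i < msize T \<and> j < msize T \<and> i \<noteq> j \<and> X $$ (i, j) \<noteq> 0}"
proof (intro equalityI subsetI)
  fix \<alpha> assume "\<alpha> \<in> involved_roots T X"
  then obtain H C where a: "\<alpha> \<in> roots T" and H: "H \<in> cartan T"
    and C: "\<And>\<beta>. \<beta> \<in> roots T \<Longrightarrow> C \<beta> \<in> root_space T \<beta>"
    and dec: "\<And>i j. i < msize T \<Longrightarrow> j < msize T \<Longrightarrow>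
      X $$ (i, j) = H $$ (i, j) + (\<Sum>\<beta>\<in>roots T. C \<beta> $$ (i, j))"
    and Ca: "C \<alpha> \<noteq> 0\<^sub>m (msize T) (msize T)"
    unfolding involved_roots_def by blast
  have dual: "\<beta> \<in> roots T \<Longrightarrow> \<beta> \<in> cartan_dual T" for \<beta> by (simp add: roots_def)
  have Cl: "C \<alpha> \<in> lie_alg T" using C[OF a] by (simp add: root_space_def)
  obtain i j where ij: "i < msize T" "j < msize T" "C \<alpha> $$ (i, j) \<noteq> 0"
    using Ca lie_alg_carrier[OF Cl] by (auto simp: mat_eq_iff)
  have ar: "\<alpha> = root_at T i j" using C[OF a] root_space_iff[OF dual[OF a]] ij by blast
  have ne: "i \<noteq> j" using ar a by (auto simp: roots_def)
  have "C \<beta> $$ (i, j) = (if \<beta> = \<alpha> then C \<alpha> $$ (i, j) else 0)" if "\<beta> \<in> roots T" for \<beta>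
  proof (cases "\<beta> = \<alpha>")
    case False
    then have "C \<beta> $$ (i, j) = 0"
      using C[OF that] root_space_iff[OF dual[OF that], of "C \<beta>"] ij(1,2) ar by blast
    then show ?thesis using False by simp
  qed simp
  then have "(\<Sum>\<beta>\<in>roots T. C \<beta> $$ (i, j)) =
      (\<Sum>\<beta>\<in>roots T. if \<beta> = \<alpha> then C \<alpha> $$ (i, j) else 0)"
    by (rule sum.cong[OF refl])
  also have "\<dots> = C \<alpha> $$ (i, j)"
    using a finite_roots by (simp add: sum.delta)
  finally have "(\<Sum>\<beta>\<in>roots T. C \<beta> $$ (i, j)) = C \<alpha> $$ (i, j)" .
  then have "X $$ (i, j) = C \<alpha> $$ (i, j)"
    using dec[OF ij(1,2)] cartan_index[OF H ij(1,2) ne] by simp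
  then show "\<alpha> \<in> {root_at T i j | i j. i < msize T \<and> j < msize T \<and> i \<noteq> j \<and> X $$ (i, j) \<noteq> 0}"
    using ij ar ne by fastforce
next
  fix \<alpha> assume "\<alpha> \<in> {root_at T i j | i j. i < msize T \<and> j < msize T \<and> i \<noteq> j \<and> X $$ (i, j) \<noteq> 0}"
  then obtain i j where a: "\<alpha> = root_at T i j" and ij: "i < msize T" "j < msize T" "i \<noteq> j"
    and Xij: "X $$ (i, j) \<noteq> 0" by auto
  let ?N = "msize T"
  have root: "root_at T p q \<in> roots T" if "p < ?N" "q < ?N" "p \<noteq> q" "X $$ (p, q) \<noteq> 0" for p q
    using nonzero_entry_root_pos[OF X that] by (rule root_at_mem_roots)
  define H where "H = mat ?N ?N (\<lambda>(p, q). if p = q then X $$ (p, q) else 0)"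
  \<comment> \<open>A position and its mirror image carry the same root, so this mask is symmetric
    and the component stays in the algebra.\<close>
  define C where "C \<beta> = mat ?N ?N (\<lambda>(p, q). if p \<noteq> q \<and> root_at T p q = \<beta> then X $$ (p, q) else 0)" for \<beta>
  have "H \<in> cartan T"
    using lie_alg_mask[OF X, of "\<lambda>p q. p = q"] by (auto simp: cartan_def diagonal_mat_def H_def)
  moreover have "C \<beta> \<in> root_space T \<beta>" if "\<beta> \<in> roots T" for \<beta>
  proof -
    have "C \<beta> \<in> lie_alg T"
      unfolding C_def using root_at_opp[of T] by (intro lie_alg_mask[OF X]) auto
    then show ?thesis using that
      by (auto simp: root_space_iff roots_def C_def split: if_splits)
  qed
  moreover have "X $$ (p, q) = H $$ (p, q) + (\<Sum>\<beta>\<in>roots T. C \<beta> $$ (p, q))"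
    if "p < ?N" "q < ?N" for p q
  proof (cases "p = q \<or> X $$ (p, q) = 0")
    case True
    then have "(\<Sum>\<beta>\<in>roots T. C \<beta> $$ (p, q)) = 0"
      using that by (intro sum.neutral) (auto simp: C_def)
    then show ?thesis using that True by (auto simp: H_def)
  next
    case False
    have "(\<Sum>\<beta>\<in>roots T. C \<beta> $$ (p, q)) =
        (\<Sum>\<beta>\<in>roots T. if \<beta> = root_at T p q then X $$ (p, q) else 0)"
      using that False by (intro sum.cong) (auto simp: C_def)
    also have "\<dots> = X $$ (p, q)"
      using root[OF that] False finite_roots by (simp add: sum.delta)
    finally show ?thesis using that False by (auto simp: H_def)
  qed
  moreover have "C \<alpha> $$ (i, j) \<noteq> 0" using a ij Xij by (simp add: C_def)
  then have "C \<alpha> \<noteq> 0\<^sub>m ?N ?N" using ij by auto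
  ultimately show "\<alpha> \<in> involved_roots T X"
    using root[OF ij Xij] a unfolding involved_roots_def by blast
qed

text \<open>Positions with the same root have the same height j - i, so a root space that meets the
  part above the diagonal lies entirely in it.\<close>

lemma root_at_positive:
  assumes "root_pos T i j" "i < j"
  shows "root_at T i j \<in> positive_roots T"
proof -
  have ij: "i < msize T" "j < msize T" using assms by (auto simp: root_pos_def)
  have "X \<in> borel T" if "X \<in> root_space T (root_at T i j)" for X
  proof -
    from that have X: "X \<in> lie_alg T" and
      s: "\<And>p q. p < msize T \<Longrightarrow> q < msize T \<Longrightarrow> X $$ (p, q) \<noteq> 0 \<Longrightarrow> root_at T i j = root_at T p q"
      using root_space_iff[OF root_at_cartan_dual[OF ij]] by auto
    have "X $$ (p, q) = 0" if "q < p" "p < msize T" for p q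
    proof (rule ccontr)
      assume "X $$ (p, q) \<noteq> 0"
      then have "root_at T i j = root_at T p q" using s that by auto
      then have "int j - int i = int q - int p"
        by (rule root_at_height) (use ij that in auto)
      then show False using assms(2) that by simp
    qed
    then show ?thesis using X lie_alg_carrier[OF X] by (auto simp: borel_def)
  qed
  then show ?thesis using root_at_mem_roots[OF assms(1)] by (auto simp: positive_roots_def)
qed

section \<open>Differences of roots\<close>

text \<open>The diagonal e_c - e_{opp c}, a test element of the Cartan subalgebra outside type A. It
  is 0 when \<open>c\<close> is the middle position of an odd size.\<close>

definition signed_unit :: "classical \<Rightarrow> nat \<Rightarrow> nat \<Rightarrow> complex" where
  "signed_unit T c a = (if a = c then 1 else 0) - (if a = opp T c then 1 else 0)"

lemma signed_unit_opp: "c < msize T \<Longrightarrow> a < msize T \<Longrightarrow> signed_unit T c (opp T a) = - signed_unit T c a"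
  by (auto simp: signed_unit_def opp_eq_iff)

text \<open>On \<open>signed_unit T j\<close> this functional has the value -2. A difference of two
  coordinates reaches -2 only at the position (opp j, j), which lies on the excluded
  skew-diagonal.\<close>

lemma opp_orthogonal_not_root:
  assumes "orthogonal_type T" "j < msize T" "j \<noteq> opp T j"
  shows "root_at T (opp T j) j \<notin> roots T"
proof
  assume "root_at T (opp T j) j \<in> roots T"
  then obtain p q where pq: "root_pos T p q" and eq: "root_at T (opp T j) j = root_at T p q"
    by (auto simp: roots_eq)
  have H: "diag_of T (signed_unit T j) \<in> cartan T"
    using assms by (simp add: diag_of_mem_cartan orthogonal_not_special_linear signed_unit_opp)
  have "signed_unit T j (opp T j) - signed_unit T j j = signed_unit T j p - signed_unit T j q"
    using fun_cong[OF eq, of "diag_of T (signed_unit T j)"] H pq assms by (simp add: root_at_def root_pos_def)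
  then have "signed_unit T j p - signed_unit T j q = - 2" using assms by (simp add: signed_unit_def)
  then have "p = opp T j \<and> q = j" by (auto simp: signed_unit_def split: if_splits)
  then show False using pq assms by (auto simp: root_pos_def)
qed

text \<open>If the difference were a root, testing it on suitable diagonals would identify it with
  e_i - e_k, and then e_j and e_l would have to agree. Both rows are taken in the upper half, so
  that \<open>i\<close>, \<open>k\<close> and their mirrors are four different positions.\<close>

lemma root_at_diff_not_root:
  assumes T: "\<not> special_linear T"
    and less: "i < j" "k < l" "j < msize T" "l < msize T" "i < opp T i" "k < opp T k"
    and ne: "i \<noteq> k" "j \<noteq> l" "j \<noteq> opp T k" "l \<noteq> opp T i"
  shows "(\<lambda>H. root_at T i j H - root_at T k l H) \<notin> roots T"
proof
  assume "(\<lambda>H. root_at T i j H - root_at T k l H) \<in> roots T"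
  then obtain p q where pq: "root_pos T p q"
    and eq: "(\<lambda>H. root_at T i j H - root_at T k l H) = root_at T p q"
    by (auto simp: roots_eq)
  have b: "i < msize T" "k < msize T" "p < msize T" "q < msize T"
    using less pq by (auto simp: root_pos_def)
  have key: "x i - x j - (x k - x l) = x p - x q"
    if "\<And>a. a < msize T \<Longrightarrow> x (opp T a) = - x a" for x :: "nat \<Rightarrow> complex"
  proof -
    have "diag_of T x \<in> cartan T" using that by (simp add: diag_of_mem_cartan[OF T])
    then show ?thesis using fun_cong[OF eq, of "diag_of T x"] b less by (simp add: root_at_def)
  qed
  have "opp T i \<noteq> k" "opp T k \<noteq> i" "opp T i \<noteq> opp T k"
    using less ne b opp_eq_iff[of i T k] opp_eq_iff[of k T i] by auto
  then obtain i' k' where opp: "opp T i = i'" "opp T k = k'"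
    and distinct: "i' \<noteq> k" "k' \<noteq> i" "i' \<noteq> k'" "i \<noteq> k" "i \<noteq> i'" "k \<noteq> k'" "i \<noteq> j" "k \<noteq> l"
      "j \<noteq> k'" "l \<noteq> i'"
    using less ne by simp
  have pmi: "signed_unit T i a = (if a = i then 1 else 0) - (if a = i' then 1 else 0)"
    and pmk: "signed_unit T k a = (if a = k then 1 else 0) - (if a = k' then 1 else 0)" for a
    by (simp_all add: signed_unit_def opp)
  \<comment> \<open>Here the difference of the two roots has the value 2 - y j + y l, which is at
    least 2, whereas no difference of two coordinates of \<open>y\<close> exceeds 2. Equality leaves
    two choices each for \<open>p\<close> and \<open>q\<close> and makes \<open>y\<close> vanish at
    \<open>j\<close> and \<open>l\<close>.\<close>
  define y where "y a = signed_unit T i a - signed_unit T k a" for a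
  have y: "(y a = 1 \<and> (a = i \<or> a = k')) \<or> (y a = - 1 \<and> (a = k \<or> a = i')) \<or>
      (y a = 0 \<and> a \<notin> {i, i', k, k'})" for a
    using distinct by (simp add: y_def pmi pmk)
  have "y i = 1" "y k = - 1" "y j \<noteq> 1" "y l \<noteq> - 1"
    using y[of i] y[of k] y[of j] y[of l] distinct by auto
  moreover have "y i - y j - (y k - y l) = y p - y q"
    using b by (intro key) (simp add: signed_unit_opp y_def)
  ultimately have v: "y p = 1 \<and> y q = - 1 \<and> y j = 0 \<and> y l = 0"
    using y[of p] y[of q] y[of j] y[of l] by (elim disjE conjE) simp_all
  have pqs: "(p = i \<or> p = k') \<and> (q = k \<or> q = i') \<and>
      j \<noteq> i' \<and> j \<noteq> k \<and> l \<noteq> i \<and> l \<noteq> k'"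
  proof (intro conjI)
    show "p = i \<or> p = k'" using y[of p] v by auto
    show "q = k \<or> q = i'" using y[of q] v by auto
    show "j \<noteq> i'" "j \<noteq> k" using y[of j] v by auto
    show "l \<noteq> i" "l \<noteq> k'" using y[of l] v by auto
  qed
  \<comment> \<open>The left side is 1. The mixed choices (i, i') and (k', k) would give 2 and 0, so
    (p, q) is (i, k) or its mirror image.\<close>
  have "signed_unit T i i - signed_unit T i j - (signed_unit T i k - signed_unit T i l) = signed_unit T i p - signed_unit T i q"
    using b by (intro key) (simp add: signed_unit_opp)
  then have pqs': "(p = i \<and> q = k) \<or> (p = k' \<and> q = i')"
    using distinct pqs by (auto simp: pmi pmk split: if_splits)
  \<comment> \<open>Cancelling e_i - e_k on both sides leaves e_j = e_l on the Cartan subalgebra.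
    Testing on the signed units of \<open>j\<close> and \<open>l\<close> puts both at the middle
    position, against j and l being different.\<close>
  have jl: "x j = x l" if "\<And>a. a < msize T \<Longrightarrow> x (opp T a) = - x a" for x :: "nat \<Rightarrow> complex"
    using key[of x, OF that] pqs' that[of i] that[of k] b by (auto simp: opp)
  have "signed_unit T j j = signed_unit T j l" "signed_unit T l j = signed_unit T l l"
    using less by (auto intro!: jl simp: signed_unit_opp)
  then have "j = opp T j \<and> l = opp T l"
    using ne by (auto simp: signed_unit_def split: if_splits)
  then show False using ne less by (auto simp: opp_def)
qed

text \<open>The same extremal argument with the trace zero diagonals e_c - e_d: the pair (i, k)
  forces p = i and q = k, and then the pair (j, l) gives -2 = 0.\<close>

lemma root_at_diff_not_root_special_linear:
  assumes T: "special_linear T"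
    and less: "i < j" "k < l" "j < msize T" "l < msize T"
    and ne: "i \<noteq> k" "j \<noteq> l"
  shows "(\<lambda>H. root_at T i j H - root_at T k l H) \<notin> roots T"
proof
  assume "(\<lambda>H. root_at T i j H - root_at T k l H) \<in> roots T"
  then obtain p q where pq: "root_pos T p q"
    and eq: "(\<lambda>H. root_at T i j H - root_at T k l H) = root_at T p q"
    by (auto simp: roots_eq)
  have b: "i < msize T" "k < msize T" "p < msize T" "q < msize T"
    using less pq by (auto simp: root_pos_def)
  define x :: "nat \<Rightarrow> nat \<Rightarrow> nat \<Rightarrow> complex"
    where "x c d a = (if a = c then 1 else 0) - (if a = d then 1 else 0)" for c d a
  have key: "x c d i - x c d j - (x c d k - x c d l) = x c d p - x c d q"
    if "c < msize T" "d < msize T" for c d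
  proof -
    have "diag_of T (x c d) \<in> cartan T"
      using that by (simp add: diag_of_mem_cartan_special_linear[OF T] x_def sum_subtractf)
    then show ?thesis using fun_cong[OF eq, of "diag_of T (x c d)"] b less by (simp add: root_at_def)
  qed
  have pqs: "p = i \<and> q = k \<and> j \<noteq> k \<and> l \<noteq> i"
    using key[OF b(1,2)] less ne by (auto simp: x_def split: if_splits)
  show False
    using key[OF less(3,4)] less ne pqs by (auto simp: x_def split: if_splits)
qed

lemma zero_not_root: "(\<lambda>_. 0) \<notin> roots T"
  by (simp add: roots_def)

text \<open>Since the support of \<open>X\<close> is symmetric about the skew-diagonal, a condition on its rows also
  covers the columns.\<close>

lemma simple_system_involved_roots_iff:
  assumes T: "\<not> special_linear T" and X: "X \<in> lie_alg T"
    and up: "\<And>i j. i < msize T \<Longrightarrow> j < msize T \<Longrightarrow> X $$ (i, j) \<noteq> 0 \<Longrightarrow> i < j"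
  shows "simple_system T (involved_roots T X) \<longleftrightarrow>
    (\<forall>i<msize T. \<forall>j<msize T. \<forall>l<msize T.
      X $$ (i, j) \<noteq> 0 \<and> X $$ (i, l) \<noteq> 0 \<and> j \<noteq> l \<longrightarrow> orthogonal_type T \<and> l = opp T j)"
    (is "?simple \<longleftrightarrow> ?rows")
proof
  have inv: "root_at T i j \<in> involved_roots T X"
    if "i < msize T" "j < msize T" "X $$ (i, j) \<noteq> 0" for i j
    using that up[OF that] unfolding involved_roots_eq[OF X] by fastforce
  have same_row: "(\<lambda>H. root_at T i j H - root_at T i l H) = root_at T l j" for i j l
    by (auto simp: root_at_def)
  show ?rows if ?simple
  proof (intro allI impI)
    fix i j l assume b: "i < msize T" "j < msize T" "l < msize T"
      and h: "X $$ (i, j) \<noteq> 0 \<and> X $$ (i, l) \<noteq> 0 \<and> j \<noteq> l"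
    have "root_at T l j \<notin> roots T"
      using that inv[OF b(1,2)] inv[OF b(1,3)] h unfolding simple_system_def
      by (metis same_row)
    then show "orthogonal_type T \<and> l = opp T j"
      using root_at_mem_roots[of T l j] b h opp_eq_iff[OF b(3,2)] by (auto simp: root_pos_def)
  qed
  show ?simple if rows: ?rows
    unfolding simple_system_def
  proof (intro conjI subsetI ballI)
    fix \<alpha> assume "\<alpha> \<in> involved_roots T X"
    then show "\<alpha> \<in> positive_roots T"
      using nonzero_entry_root_pos[OF X] up by (auto simp: involved_roots_eq[OF X] intro!: root_at_positive)
  next
    fix \<alpha> \<beta> assume \<alpha>: "\<alpha> \<in> involved_roots T X" and \<beta>: "\<beta> \<in> involved_roots T X"
    \<comment> \<open>Every involved root has a position in the upper half of the rows: otherwise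
      its mirror image is one. This is the normal form required by
      \<open>root_at_diff_not_root\<close>.\<close>
    have normal: "\<exists>i j. i < j \<and> j < msize T \<and> i < opp T i \<and> X $$ (i, j) \<noteq> 0 \<and> \<gamma> = root_at T i j"
      if g: "\<gamma> \<in> involved_roots T X" for \<gamma>
    proof -
      obtain i j where ij: "i < msize T" "j < msize T" "X $$ (i, j) \<noteq> 0" "\<gamma> = root_at T i j"
        using g by (auto simp: involved_roots_eq[OF X])
      have "i < j" using up ij by blast
      show ?thesis
      proof (cases "i < opp T i")
        case True
        then show ?thesis using ij \<open>i < j\<close> by blast
      next
        case False
        then have "opp T j < opp T i" "opp T i < msize T" "opp T j < opp T (opp T j)"
          using ij \<open>i < j\<close> by (auto simp: opp_def)
        moreover have "X $$ (opp T j, opp T i) \<noteq> 0" "\<gamma> = root_at T (opp T j) (opp T i)"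
          using ij lie_alg_flip_nonzero[OF T X] root_at_opp[OF T] by auto
        ultimately show ?thesis by blast
      qed
    qed
    \<comment> \<open>Roots of two entries in one row differ by \<open>root_at T l j\<close>, which
      is 0 or, for mirrored columns, twice a coordinate, and neither is a root of an orthogonal
      algebra.\<close>
    have row: "(\<lambda>H. root_at T i j H - root_at T i l H) \<notin> roots T"
      if "i < msize T" "j < msize T" "l < msize T" "X $$ (i, j) \<noteq> 0" "X $$ (i, l) \<noteq> 0" for i j l
    proof (cases "j = l")
      case False
      then have "orthogonal_type T" "l = opp T j" using rows that by auto
      then show ?thesis
        using opp_orthogonal_not_root[of T j] False that by (simp add: same_row)
    qed (simp add: zero_not_root)
    obtain i j where ij: "i < j" "j < msize T" "i < opp T i" "X $$ (i, j) \<noteq> 0" "\<alpha> = root_at T i j"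
      using normal[OF \<alpha>] by blast
    obtain k l where kl: "k < l" "l < msize T" "k < opp T k" "X $$ (k, l) \<noteq> 0" "\<beta> = root_at T k l"
      using normal[OF \<beta>] by blast
    have ik: "i < msize T" "k < msize T" using ij kl by auto
    have flips: "X $$ (opp T j, opp T i) \<noteq> 0" "X $$ (opp T l, opp T k) \<noteq> 0"
      using lie_alg_flip_nonzero[OF T X] ij kl ik by auto
    \<comment> \<open>A shared column is a shared row of the mirror images; with both rows in the
      upper half it is impossible. In the third and fourth case one entry shares its row with the
      mirror image of the other.\<close>
    consider "i = k" | "i \<noteq> k" "j = l" | "j = opp T k" | "l = opp T i"
      | "i \<noteq> k" "j \<noteq> l" "j \<noteq> opp T k" "l \<noteq> opp T i" by blast
    then show "(\<lambda>H. \<alpha> H - \<beta> H) \<notin> roots T"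
    proof cases
      case 1
      then show ?thesis using row[of i j l] ij kl by simp
    next
      case 2
      then have "opp T k = opp T (opp T i)"
        using rows[rule_format, of "opp T j" "opp T i" "opp T k"] flips ij kl ik by auto
      then show ?thesis using ij kl ik 2 by (auto simp: opp_def)
    next
      case 3
      then have "\<alpha> = root_at T k (opp T i)" "X $$ (k, opp T i) \<noteq> 0"
        using flips ij ik root_at_opp[OF T, of i j] by auto
      then show ?thesis using row[of k "opp T i" l] kl ik by simp
    next
      case 4
      then have "\<beta> = root_at T i (opp T k)" "X $$ (i, opp T k) \<noteq> 0"
        using flips kl ik root_at_opp[OF T, of k l] by auto
      then show ?thesis using row[of i j "opp T k"] ij ik by simp
    next
      case 5
      then show ?thesis using root_at_diff_not_root[OF T] ij kl by simp
    qed
  qed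
qed

lemma simple_system_involved_roots_special_linear:
  assumes T: "special_linear T" and X: "X \<in> lie_alg T"
    and up: "\<And>i j. i < msize T \<Longrightarrow> j < msize T \<Longrightarrow> X $$ (i, j) \<noteq> 0 \<Longrightarrow> i < j"
    and rows: "\<And>i j l. \<lbrakk>i < msize T; j < msize T; l < msize T; X $$ (i, j) \<noteq> 0; X $$ (i, l) \<noteq> 0\<rbrakk> \<Longrightarrow> j = l"
    and cols: "\<And>i j k. \<lbrakk>i < msize T; j < msize T; k < msize T; X $$ (i, j) \<noteq> 0; X $$ (k, j) \<noteq> 0\<rbrakk> \<Longrightarrow> i = k"
  shows "simple_system T (involved_roots T X)"
  unfolding simple_system_def
proof (intro conjI subsetI ballI)
  fix \<alpha> assume "\<alpha> \<in> involved_roots T X"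
  then show "\<alpha> \<in> positive_roots T"
    using nonzero_entry_root_pos[OF X] up by (auto simp: involved_roots_eq[OF X] intro!: root_at_positive)
next
  fix \<alpha> \<beta> assume "\<alpha> \<in> involved_roots T X" "\<beta> \<in> involved_roots T X"
  then obtain i j k l where ij: "i < msize T" "j < msize T" "X $$ (i, j) \<noteq> 0" "\<alpha> = root_at T i j"
    and kl: "k < msize T" "l < msize T" "X $$ (k, l) \<noteq> 0" "\<beta> = root_at T k l"
    by (auto simp: involved_roots_eq[OF X])
  show "(\<lambda>H. \<alpha> H - \<beta> H) \<notin> roots T"
  proof (cases "i = k \<or> j = l")
    case True
    then have "i = k" "j = l" using rows[of i j l] cols[of i j k] ij kl by auto
    then show ?thesis using ij kl by (simp add: zero_not_root)
  next
    case False
    then show ?thesis using root_at_diff_not_root_special_linear[OF T] up ij kl by simp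
  qed
qed

section \<open>Block structure and the element \<open>X\<^sub>R\<close>\<close>

lemma block_sequence_sum: "block_sequence T ds \<Longrightarrow> sum_list ds = msize T"
  by (cases T) auto

lemma block_sequence_rev: "block_sequence T ds \<Longrightarrow> \<not> special_linear T \<Longrightarrow> rev ds = ds"
  by (cases T) (auto simp: special_linear_def)

lemma sum_list_take_mono:
  fixes ds :: "nat list"
  assumes "i \<le> j"
  shows "sum_list (take i ds) \<le> sum_list (take j ds)"
proof -
  have "take j ds = take i ds @ take (j - i) (drop i ds)"
    using assms by (metis le_add_diff_inverse take_add)
  then show ?thesis by simp
qed

lemma block_start_Suc:
  assumes "1 \<le> s" "s \<le> length ds"
  shows "block_start ds (Suc s) = block_start ds s + blen ds s"
proof -
  obtain k where "s = Suc k" using assms by (cases s) auto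
  then show ?thesis using assms by (simp add: block_start_def blen_def take_Suc_conv_app_nth)
qed

lemma block_start_add_less:
  assumes "1 \<le> s" "s \<le> length ds" "u < blen ds s"
  shows "block_start ds s + u < sum_list ds"
proof -
  have "block_start ds s + u < sum_list (take s ds)"
    using block_start_Suc[OF assms(1,2)] assms(3) by (simp add: block_start_def)
  also have "\<dots> \<le> sum_list (take (length ds) ds)" by (rule sum_list_take_mono) fact
  finally show ?thesis by simp
qed

lemma block_of_eq:
  assumes "1 \<le> s" "s \<le> length ds" "u < blen ds s"
  shows "block_of ds (block_start ds s + u) = s"
  unfolding block_of_def
proof (rule Least_equality)
  show "block_start ds s + u < sum_list (take s ds)"
    using block_start_Suc[OF assms(1,2)] assms(3) by (simp add: block_start_def)
next
  fix i assume i: "block_start ds s + u < sum_list (take i ds)"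
  show "s \<le> i"
  proof (rule ccontr)
    assume "\<not> s \<le> i"
    then have "sum_list (take i ds) \<le> sum_list (take (s - 1) ds)"
      by (intro sum_list_take_mono) simp
    then show False using i by (simp add: block_start_def)
  qed
qed

lemma block_decomposition:
  assumes "p < sum_list ds"
  obtains s u where "1 \<le> s" "s \<le> length ds" "u < blen ds s" "p = block_start ds s + u" "block_of ds p = s"
proof -
  define s where "s = block_of ds p"
  have L: "p < sum_list (take (length ds) ds)" using assms by simp
  have 1: "p < sum_list (take s ds)" unfolding s_def block_of_def by (rule LeastI, rule L)
  have 2: "s \<le> length ds" unfolding s_def block_of_def by (rule Least_le, rule L)
  have 3: "1 \<le> s" using 1 by (cases s) auto
  have 4: "\<not> p < sum_list (take (s - 1) ds)"
    using 3 unfolding s_def block_of_def by (intro not_less_Least) simp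
  have 5: "p < block_start ds s + blen ds s"
    using 1 block_start_Suc[OF 3 2] by (simp add: block_start_def)
  show ?thesis
    by (rule that[of s "p - block_start ds s"])
      (use 1 2 3 4 5 in \<open>auto simp: block_start_def s_def\<close>)
qed

lemma block_of_mono:
  assumes "p \<le> q" "q < sum_list ds"
  shows "block_of ds p \<le> block_of ds q"
proof -
  have "q < sum_list (take (block_of ds q) ds)"
    unfolding block_of_def by (rule LeastI[of _ "length ds"]) (use assms in simp)
  then show ?thesis
    unfolding block_of_def[of ds p] using assms by (intro Least_le) simp
qed

lemma blen_opp:
  assumes "rev ds = ds" "1 \<le> s" "s \<le> length ds"
  shows "blen ds (length ds + 1 - s) = blen ds s"
proof -
  have "rev ds ! (s - 1) = ds ! (length ds - s)"
    using assms by (subst rev_nth) auto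
  then show ?thesis using assms by (simp add: blen_def)
qed

lemma block_start_opp:
  assumes "rev ds = ds" "1 \<le> s" "s \<le> length ds"
  shows "block_start ds (length ds + 1 - s) + blen ds s + block_start ds s = sum_list ds"
proof -
  have "take (length ds - s) ds = rev (drop s ds)"
    using assms take_rev[of "length ds - s" ds] by simp
  then have "sum_list (take (length ds - s) ds) = sum_list (drop s ds)" by simp
  moreover have "sum_list (take s ds) + sum_list (drop s ds) = sum_list ds"
    by (metis append_take_drop_id sum_list_append)
  ultimately show ?thesis
    using block_start_Suc[OF assms(2,3)] by (simp add: block_start_def)
qed

lemma opp_block_start:
  assumes "rev ds = ds" "sum_list ds = msize T" "1 \<le> s" "s \<le> length ds" "u < blen ds s"
  shows "opp T (block_start ds s + u) = block_start ds (length ds + 1 - s) + (blen ds s - 1 - u)"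
  using block_start_opp[OF assms(1,3,4)] assms by (simp add: opp_def)

lemma block_of_opp:
  assumes "rev ds = ds" "sum_list ds = msize T" "p < msize T"
  shows "block_of ds (opp T p) = length ds + 1 - block_of ds p"
proof -
  obtain s u where su: "1 \<le> s" "s \<le> length ds" "u < blen ds s" "p = block_start ds s + u"
    "block_of ds p = s"
    using block_decomposition assms by metis
  show ?thesis
    using opp_block_start[OF assms(1,2) su(1-3)] su blen_opp[OF assms(1) su(1,2)]
      block_of_eq[of "length ds + 1 - s" ds "blen ds s - 1 - u"] by simp
qed

lemma graded_part_one_iff:
  "X \<in> graded_part T ds 1 \<longleftrightarrow> X \<in> lie_alg T \<and>
    (\<forall>p<msize T. \<forall>q<msize T. X $$ (p, q) \<noteq> 0 \<longrightarrow> block_of ds q = Suc (block_of ds p))"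
proof -
  have "int a - int b = 1 \<longleftrightarrow> a = Suc b" for a b by auto
  then show ?thesis by (simp add: graded_part_def)
qed

lemma graded_part_one_upper:
  assumes "X \<in> graded_part T ds 1" "sum_list ds = msize T"
    "p < msize T" "q < msize T" "X $$ (p, q) \<noteq> 0"
  shows "p < q"
proof (rule ccontr)
  assume "\<not> p < q"
  then have "block_of ds q \<le> block_of ds p" using assms by (intro block_of_mono) auto
  moreover have "block_of ds q = Suc (block_of ds p)"
    using assms(1,3-5) unfolding graded_part_one_iff by blast
  ultimately show False by simp
qed

lemma graded_part_one_entry:
  assumes "X \<in> graded_part T ds 1" "sum_list ds = msize T"
    "p < msize T" "q < msize T" "X $$ (p, q) \<noteq> 0"
  obtains s u v where "1 \<le> s" "s < length ds" "u < blen ds s" "v < blen ds (Suc s)"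
    "p = block_start ds s + u" "q = block_start ds (Suc s) + v"
proof -
  obtain s u where su: "1 \<le> s" "s \<le> length ds" "u < blen ds s" "p = block_start ds s + u"
    "block_of ds p = s"
    using block_decomposition assms(2,3) by metis
  obtain t v where tv: "1 \<le> t" "t \<le> length ds" "v < blen ds t" "q = block_start ds t + v"
    "block_of ds q = t"
    using block_decomposition assms(2,4) by metis
  have "block_of ds q = Suc (block_of ds p)"
    using assms(1,3-5) unfolding graded_part_one_iff by blast
  then have t: "t = Suc s" using su(5) tv(5) by simp
  show ?thesis using that[of s u v] su tv unfolding t by simp
qed

section \<open>Shape and skew-symmetry of the prescribed rectangles\<close>

lemma ones_mat_carrier [simp]: "ones_mat a b S \<in> carrier_mat a b"
  by (simp add: ones_mat_def)

lemma corners_carrier [simp]: "corners a b k m \<in> carrier_mat a b"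
  by (simp add: corners_def)

lemma central_square_BD_carrier [simp]: "central_square_BD i a \<in> carrier_mat a a"
  by (simp add: central_square_BD_def)

lemma J_mat_carrier [simp]: "J_mat a \<in> carrier_mat a a"
  by (simp add: J_mat_def)

text \<open>Reflection in the skew-diagonal of the square exchanges the entry 1 and the entry -1 of
  the block with the same number k.\<close>

lemma central_square_BD_skew:
  assumes "u < a" "v < a"
  shows "central_square_BD i a $$ (a - 1 - v, a - 1 - u) = - central_square_BD i a $$ (u, v)"
proof -
  define P where "P u v \<longleftrightarrow> (\<exists>k\<in>{1..a div 2}. (u + 1, v + 1) =
      (if odd i then (a + 1 - 2 * k, 2 * k - 1) else (2 * k - 1, a + 1 - 2 * k)))" for u v :: nat
  define M where "M u v \<longleftrightarrow> (\<exists>k\<in>{1..a div 2}. (u + 1, v + 1) =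
      (if odd i then (a + 2 - 2 * k, 2 * k) else (2 * k, a + 2 - 2 * k)))" for u v :: nat
  have e: "central_square_BD i a $$ (u, v) = (if P u v then 1 else if M u v then - 1 else 0)"
    if "u < a" "v < a" for u v
    using that by (simp add: central_square_BD_def P_def M_def)
  have "P (a - 1 - v) (a - 1 - u) \<longleftrightarrow> M u v" if "u < a" "v < a" for u v
    unfolding P_def M_def using that by (intro bex_cong refl) auto
  moreover from this[of "a - 1 - v" "a - 1 - u"] assms
  have "M (a - 1 - v) (a - 1 - u) \<longleftrightarrow> P u v" by auto
  \<comment> \<open>The two kinds of position are told apart by a parity, of the column for odd
    \<open>i\<close> and of the row for even \<open>i\<close>.\<close>
  moreover have "\<not> (P u v \<and> M u v)"
  proof
    assume "P u v \<and> M u v"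
    then have "(\<exists>k. v + 1 = 2 * k - 1 \<and> 1 \<le> k) \<and> (\<exists>k. v + 1 = 2 * k) \<or>
        (\<exists>k. u + 1 = 2 * k - 1 \<and> 1 \<le> k) \<and> (\<exists>k. u + 1 = 2 * k)"
      by (auto simp: P_def M_def split: if_splits)
    then show False by presburger
  qed
  ultimately show ?thesis using assms by (auto simp: e)
qed

lemma rect_A_carrier [simp]: "rect_A ds i \<in> carrier_mat (blen ds i) (blen ds (Suc i))"
  by (simp add: rect_A_def Let_def)

lemma rect_carrier:
  assumes bs: "block_sequence T ds" and i: "1 \<le> i" "i \<le> num_rects T ds"
  shows "rect T ds i \<in> carrier_mat (blen ds i) (blen ds (Suc i))"
proof (cases "special_linear T")
  case True
  then obtain n where "T = TypeA n" by (auto simp: special_linear_def)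
  then show ?thesis by simp
next
  case False
  have "blen ds (Suc i) = blen ds i" if "even (length ds)" "\<not> i < length ds div 2"
  proof -
    have "num_rects T ds = length ds div 2" using False by (cases T) (auto simp: special_linear_def)
    then have "length ds + 1 - i = Suc i" "i \<le> length ds"
      using i that by (auto elim!: evenE)
    then show ?thesis using blen_opp[OF block_sequence_rev[OF bs False] i(1)] by simp
  qed
  then have center: "J_mat (blen ds i) \<in> carrier_mat (blen ds i) (blen ds (Suc i))"
    "central_square_BD i (blen ds i) \<in> carrier_mat (blen ds i) (blen ds (Suc i))"
    if "even (length ds)" "\<not> i < length ds div 2" using that by simp_all
  have if_mem: "(if c then A else B) \<in> S" if "c \<Longrightarrow> A \<in> S" "\<not> c \<Longrightarrow> B \<in> S"
    for c and A B :: "complex mat" and S using that by simp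
  have "rect_C ds i \<in> carrier_mat (blen ds i) (blen ds (Suc i))"
    "rect_BD ds i \<in> carrier_mat (blen ds i) (blen ds (Suc i))"
    unfolding rect_C_def rect_BD_def Let_def Suc_eq_plus1[symmetric]
    by (intro if_mem center ones_mat_carrier corners_carrier rect_A_carrier; assumption)+
  then show ?thesis using False by (cases T) (simp_all add: special_linear_def)
qed

text \<open>For an even number of blocks the central square is its own mirror image, so it must
  satisfy the reflection rule by itself. For sp the square J is symmetric and \<open>tau\<close> has
  opposite signs on its rows and columns; for so the pattern of signs does it.\<close>

lemma rect_center_flip:
  assumes T: "\<not> special_linear T" and bs: "block_sequence T ds" and L: "length ds = 2 * r"
    and uv: "u < blen ds r" "v < blen ds r" and r: "1 \<le> r"
  shows "rect T ds r $$ (blen ds r - 1 - v, blen ds r - 1 - u) =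
    - tau T (block_start ds r + u) * tau T (block_start ds (Suc r) + v) * rect T ds r $$ (u, v)"
proof -
  show ?thesis
  proof (cases "orthogonal_type T")
    case True
    then have "rect T ds r = central_square_BD r (blen ds r)"
      using T L by (cases T) (auto simp: rect_BD_def special_linear_def Let_def)
    then show ?thesis using central_square_BD_skew uv True by (simp add: tau_orthogonal)
  next
    case False
    then obtain n where n: "T = TypeC n" using T by (cases T) (auto simp: special_linear_def)
    have "block_start ds (Suc r) + blen ds r + block_start ds r = 2 * n"
      using block_start_opp[OF block_sequence_rev[OF bs T] r] block_sequence_sum[OF bs] L n r
      by (simp add: Suc_diff_le mult_2)
    moreover have "block_start ds (Suc r) = block_start ds r + blen ds r"
      using block_start_Suc[OF r] L by simp
    ultimately have "tau T (block_start ds r + u) = 1" "tau T (block_start ds (Suc r) + v) = -1"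
      using uv n by auto
    moreover have "rect T ds r = J_mat (blen ds r)"
      using n L by (simp add: rect_C_def Let_def)
    ultimately show ?thesis using uv by (auto simp: J_mat_def)
  qed
qed

lemma rect_of_entry:
  assumes "u < blen ds s" "v < blen ds (Suc s)"
  shows "rect_of ds X s $$ (u, v) = X $$ (block_start ds s + u, block_start ds (Suc s) + v)"
  using assms by (simp add: rect_of_def)

lemma num_rects_bound: "1 \<le> i \<Longrightarrow> i \<le> num_rects T ds \<Longrightarrow> Suc i \<le> length ds"
  by (cases T) auto

lemma num_rects_not_special_linear: "\<not> special_linear T \<Longrightarrow> num_rects T ds = length ds div 2"
  by (cases T) (auto simp: special_linear_def)

lemma num_rects_special_linear: "special_linear T \<Longrightarrow> num_rects T ds = length ds - 1"
  by (auto simp: special_linear_def)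

text \<open>Justifies the definite description. Each position on the block superdiagonal lies in a
  prescribed rectangle or is the mirror image of such a position, and the reflection rule then
  determines its entry; only the self-mirrored central square needs a compatibility check.\<close>

lemma X_R_spec:
  assumes bs: "block_sequence T ds"
  shows "X_R T ds \<in> graded_part T ds 1 \<and>
    (\<forall>i\<in>{1..num_rects T ds}. rect_of ds (X_R T ds) i = rect T ds i)"
  unfolding X_R_def
proof (rule theI', rule ex_ex1I)
  note sum = block_sequence_sum[OF bs]
  define N nr where "N = msize T" and "nr = num_rects T ds"
  define val where "val p q = rect T ds (block_of ds p) $$
      (p - block_start ds (block_of ds p), q - block_start ds (block_of ds q))" for p q
  define f where "f p q = (if block_of ds q = Suc (block_of ds p)
      then if block_of ds p \<le> nr then val p q else - tau T p * tau T q * val (opp T q) (opp T p)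
      else 0)" for p q
  define X where "X = mat N N (\<lambda>(p, q). f p q)"
  have Xi: "X $$ (p, q) = f p q" if "p < N" "q < N" for p q
    using that by (simp add: X_def)
  have Xc: "X \<in> carrier_mat N N" by (simp add: X_def)
  have Xl: "X \<in> lie_alg T"
  proof (cases "special_linear T")
    case True
    have "f i i = 0" for i by (simp add: f_def)
    then show ?thesis
      unfolding lie_alg_special_linear_iff[OF True] using Xc Xi by (simp add: N_def)
  next
    case False
    note rev = block_sequence_rev[OF bs False]
    have nr: "nr = length ds div 2" using num_rects_not_special_linear[OF False] by (simp add: nr_def)
    have "f (opp T q) (opp T p) = - tau T p * tau T q * f p q" if pq: "p < N" "q < N" for p q
    proof -
      obtain s u where su: "1 \<le> s" "s \<le> length ds" "u < blen ds s" "p = block_start ds s + u"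
        "block_of ds p = s"
        using block_decomposition pq sum unfolding N_def by metis
      obtain t v where tv: "1 \<le> t" "t \<le> length ds" "v < blen ds t" "q = block_start ds t + v"
        "block_of ds q = t"
        using block_decomposition pq sum unfolding N_def by metis
      have os: "block_of ds (opp T p) = length ds + 1 - s" "block_of ds (opp T q) = length ds + 1 - t"
        using block_of_opp[OF rev sum] pq su tv by (auto simp: N_def)
      have oo: "opp T (opp T p) = p" "opp T (opp T q) = q" using pq by (auto simp: N_def)
      have t4: "tau T p * tau T q * (tau T p * tau T q) = 1"
        using tau_cases[of T p] tau_cases[of T q] by auto
      show ?thesis
      proof (cases "t = Suc s")
        case t: True
        have o: "block_of ds (opp T q) = length ds - s" "block_of ds (opp T p) = Suc (length ds - s)"
          using os t tv by auto
        \<comment> \<open>Position in the second half; position in the first half with mirror in the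
          second; position in the central square, where both are prescribed.\<close>
        consider "nr < s" | "s \<le> nr" "nr < length ds - s" | "s \<le> nr" "length ds - s \<le> nr" by linarith
        then show ?thesis
        proof cases
          case 1
          then have "length ds - s \<le> nr" by (simp add: nr)
          then have "f (opp T q) (opp T p) = val (opp T q) (opp T p)" by (simp add: f_def o)
          moreover have "f p q = - tau T p * tau T q * val (opp T q) (opp T p)"
            using 1 t su tv by (simp add: f_def)
          ultimately show ?thesis using t4 by (simp add: mult.assoc[symmetric])
        next
          case 2
          then have "f (opp T q) (opp T p) = - (tau T (opp T p) * tau T (opp T q)) * val p q"
            by (simp add: f_def o oo mult.commute)
          moreover have "f p q = val p q" using 2 t su tv by (simp add: f_def)
          ultimately show ?thesis using tau_opp_mult[of p T q] pq by (simp add: N_def)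
        next
          case 3
          then have r: "s = nr" "length ds = 2 * s" using nr t tv by auto
          have b: "blen ds (Suc s) = blen ds s"
            using blen_opp[OF rev, of s] r su by (simp add: Suc_diff_le mult_2)
          have "f (opp T q) (opp T p) = val (opp T q) (opp T p)" "f p q = val p q"
            using 3 o t su tv by (auto simp: f_def)
          moreover have "opp T q = block_start ds s + (blen ds s - 1 - v)"
            using opp_block_start[OF rev sum tv(1-3)] tv t r b by simp
          moreover have "opp T p = block_start ds (Suc s) + (blen ds s - 1 - u)"
            using opp_block_start[OF rev sum su(1-3)] su r by (simp add: Suc_diff_le mult_2)
          ultimately show ?thesis
            using rect_center_flip[OF False bs r(2) su(3) _ su(1), of v] tv su t b o r
            by (simp add: val_def)
        qed
      next
        case False
        then have "block_of ds (opp T p) \<noteq> Suc (block_of ds (opp T q))"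
          using os su tv by auto
        then show ?thesis using False su tv by (simp add: f_def)
      qed
    qed
    then show ?thesis
      unfolding lie_alg_iff[OF False] using Xc Xi by (auto simp: N_def)
  qed
  have "X \<in> graded_part T ds 1"
    unfolding graded_part_one_iff using Xl Xi by (auto simp: N_def f_def split: if_splits)
  moreover have "rect_of ds X i = rect T ds i" if i: "i \<in> {1..num_rects T ds}" for i
  proof (rule eq_matI)
    have c: "rect T ds i \<in> carrier_mat (blen ds i) (blen ds (Suc i))"
      using rect_carrier[OF bs] i by simp
    then show "dim_row (rect_of ds X i) = dim_row (rect T ds i)"
      "dim_col (rect_of ds X i) = dim_col (rect T ds i)" by (auto simp: rect_of_def)
    fix u v assume "u < dim_row (rect T ds i)" "v < dim_col (rect T ds i)"
    then have uv: "u < blen ds i" "v < blen ds (Suc i)" using c by auto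
    have iL: "1 \<le> i" "i \<le> length ds" "Suc i \<le> length ds" using i num_rects_bound[of i T ds] by auto
    have "f (block_start ds i + u) (block_start ds (Suc i) + v) = rect T ds i $$ (u, v)"
      using block_of_eq[OF iL(1,2) uv(1)] block_of_eq[of "Suc i" ds v] uv iL i
      by (simp add: f_def val_def nr_def)
    then show "rect_of ds X i $$ (u, v) = rect T ds i $$ (u, v)"
      using rect_of_entry[OF uv, of X] block_start_add_less[OF iL(1,2) uv(1)]
        block_start_add_less[of "Suc i" ds v] uv iL sum Xi by (simp add: N_def)
  qed
  ultimately show "\<exists>X. X \<in> graded_part T ds 1 \<and> (\<forall>i\<in>{1..num_rects T ds}. rect_of ds X i = rect T ds i)"
    by blast
next
  note sum = block_sequence_sum[OF bs]
  fix X Y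
  assume X: "X \<in> graded_part T ds 1 \<and> (\<forall>i\<in>{1..num_rects T ds}. rect_of ds X i = rect T ds i)"
    and Y: "Y \<in> graded_part T ds 1 \<and> (\<forall>i\<in>{1..num_rects T ds}. rect_of ds Y i = rect T ds i)"
  have l: "X \<in> lie_alg T" "Y \<in> lie_alg T" using X Y by (auto simp: graded_part_one_iff)
  have prescribed: "X $$ (p, q) = Y $$ (p, q)"
    if pq: "p < msize T" "q < msize T" and b: "block_of ds q = Suc (block_of ds p)"
      "block_of ds p \<le> num_rects T ds" for p q
  proof -
    obtain s u where su: "1 \<le> s" "s \<le> length ds" "u < blen ds s" "p = block_start ds s + u"
      "block_of ds p = s"
      using block_decomposition pq sum by metis
    obtain t v where tv: "1 \<le> t" "t \<le> length ds" "v < blen ds t" "q = block_start ds t + v"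
      "block_of ds q = t"
      using block_decomposition pq sum by metis
    have "rect_of ds X s = rect_of ds Y s" using X Y su b by simp
    then show ?thesis using rect_of_entry[of u ds s v] su tv b by metis
  qed
  show "X = Y"
  proof (rule eq_matI)
    show "dim_row X = dim_row Y" "dim_col X = dim_col Y"
      using l[THEN lie_alg_carrier] by auto
    fix p q assume "p < dim_row Y" "q < dim_col Y"
    then have pq: "p < msize T" "q < msize T" using lie_alg_carrier[OF l(2)] by auto
    consider "block_of ds q \<noteq> Suc (block_of ds p)"
      | "block_of ds q = Suc (block_of ds p)" "block_of ds p \<le> num_rects T ds"
      | "block_of ds q = Suc (block_of ds p)" "num_rects T ds < block_of ds p" by linarith
    then show "X $$ (p, q) = Y $$ (p, q)"
    proof cases
      case 1
      then have "X $$ (p, q) = 0" "Y $$ (p, q) = 0"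
        using X Y pq unfolding graded_part_one_iff by blast+
      then show ?thesis by simp
    next
      case 2
      then show ?thesis using prescribed pq by blast
    next
      case 3
      have q: "block_of ds q \<le> length ds"
        using block_decomposition[of q ds] pq sum by metis
      \<comment> \<open>In type A all rectangles of the superdiagonal are prescribed, so an entry
        beyond them exists only in the other types.\<close>
      have T: "\<not> special_linear T"
        using 3 q num_rects_special_linear[of T ds] by auto
      note rev = block_sequence_rev[OF bs T]
      have "block_of ds (opp T p) = Suc (block_of ds (opp T q))"
        "block_of ds (opp T q) \<le> num_rects T ds"
        using block_of_opp[OF rev sum] pq q 3 num_rects_not_special_linear[OF T, of ds] by auto
      then have "X $$ (opp T q, opp T p) = Y $$ (opp T q, opp T p)"
        using prescribed pq by simp
      then show ?thesis
        using lie_alg_flip[OF T l(1) pq] lie_alg_flip[OF T l(2) pq] by simp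
    qed
  qed
qed

lemma X_R_graded: "block_sequence T ds \<Longrightarrow> X_R T ds \<in> graded_part T ds 1"
  using X_R_spec by blast

lemma X_R_entry:
  assumes "block_sequence T ds" "1 \<le> s" "s \<le> num_rects T ds" "u < blen ds s" "v < blen ds (Suc s)"
  shows "X_R T ds $$ (block_start ds s + u, block_start ds (Suc s) + v) = rect T ds s $$ (u, v)"
  using X_R_spec[OF assms(1)] rect_of_entry[OF assms(4,5)] assms(2,3) by (metis atLeastAtMost_iff)

section \<open>The criterion in terms of the rectangles\<close>

definition unique_rows :: "complex mat \<Rightarrow> bool" where
  "unique_rows R \<longleftrightarrow> (\<forall>u<dim_row R. \<forall>v<dim_col R. \<forall>w<dim_col R.
     R $$ (u, v) \<noteq> 0 \<and> R $$ (u, w) \<noteq> 0 \<longrightarrow> v = w)"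

definition unique_cols :: "complex mat \<Rightarrow> bool" where
  "unique_cols R \<longleftrightarrow> (\<forall>u<dim_row R. \<forall>t<dim_row R. \<forall>v<dim_col R.
     R $$ (u, v) \<noteq> 0 \<and> R $$ (t, v) \<noteq> 0 \<longrightarrow> u = t)"

lemma unique_colsD:
  "unique_cols R \<Longrightarrow> R $$ (u, v) \<noteq> 0 \<Longrightarrow> R $$ (t, v) \<noteq> 0 \<Longrightarrow>
    u < dim_row R \<Longrightarrow> t < dim_row R \<Longrightarrow> v < dim_col R \<Longrightarrow> u = t"
  unfolding unique_cols_def by blast

lemma unique_rowsD:
  "unique_rows R \<Longrightarrow> R $$ (u, v) \<noteq> 0 \<Longrightarrow> R $$ (u, w) \<noteq> 0 \<Longrightarrow>
    u < dim_row R \<Longrightarrow> v < dim_col R \<Longrightarrow> w < dim_col R \<Longrightarrow> v = w"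
  unfolding unique_rows_def by blast

text \<open>Within the central block \<open>opp T\<close> reverses the column index, so this permits
  exactly the harmless pairs e_i - e_j, e_i + e_j.\<close>

definition mirror_rows :: "complex mat \<Rightarrow> bool" where
  "mirror_rows R \<longleftrightarrow> (\<forall>u<dim_row R. \<forall>v<dim_col R. \<forall>w<dim_col R.
     R $$ (u, v) \<noteq> 0 \<and> R $$ (u, w) \<noteq> 0 \<longrightarrow> v = w \<or> w = dim_col R - 1 - v)"

lemma simple_system_S1_special_linear:
  assumes T: "special_linear T" and bs: "block_sequence T ds"
    and rows: "\<And>s. 1 \<le> s \<Longrightarrow> s < length ds \<Longrightarrow> unique_rows (rect T ds s) \<and> unique_cols (rect T ds s)"
  shows "simple_system T (S1 T ds)"
proof -
  note sum = block_sequence_sum[OF bs] and X = X_R_graded[OF bs]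
  have e: "X_R T ds $$ (block_start ds s + u, block_start ds (Suc s) + v) = rect T ds s $$ (u, v)"
    if "1 \<le> s" "s < length ds" "u < blen ds s" "v < blen ds (Suc s)" for s u v
    using X_R_entry[OF bs] that num_rects_special_linear[OF T] by simp
  have c: "dim_row (rect T ds s) = blen ds s" "dim_col (rect T ds s) = blen ds (Suc s)"
    if "1 \<le> s" "s < length ds" for s
  proof -
    have "s \<le> num_rects T ds" using that num_rects_special_linear[OF T, of ds] by simp
    then show "dim_row (rect T ds s) = blen ds s" "dim_col (rect T ds s) = blen ds (Suc s)"
      using rect_carrier[OF bs that(1)] by auto
  qed
  show ?thesis
    unfolding S1_def
  proof (rule simple_system_involved_roots_special_linear[OF T])
    show "X_R T ds \<in> lie_alg T" using X by (simp add: graded_part_one_iff)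
    show "i < j" if "i < msize T" "j < msize T" "X_R T ds $$ (i, j) \<noteq> 0" for i j
      using graded_part_one_upper[OF X sum that] .
  next
    fix i j l assume h: "i < msize T" "j < msize T" "l < msize T"
      "X_R T ds $$ (i, j) \<noteq> 0" "X_R T ds $$ (i, l) \<noteq> 0"
    obtain s u v where s: "1 \<le> s" "s < length ds" "u < blen ds s" "v < blen ds (Suc s)"
      "i = block_start ds s + u" "j = block_start ds (Suc s) + v"
      using graded_part_one_entry[OF X sum h(1,2,4)] by metis
    obtain t u' w where t: "1 \<le> t" "t < length ds" "u' < blen ds t" "w < blen ds (Suc t)"
      "i = block_start ds t + u'" "l = block_start ds (Suc t) + w"
      using graded_part_one_entry[OF X sum h(1,3,5)] by metis
    have "t = s" using block_of_eq[of s ds u] block_of_eq[of t ds u'] s t by simp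
    then show "j = l" using rows[of s] c[of s] e[of s u v] e[of s u w] s t h
      by (auto simp: unique_rows_def)
  next
    fix i j k assume h: "i < msize T" "j < msize T" "k < msize T"
      "X_R T ds $$ (i, j) \<noteq> 0" "X_R T ds $$ (k, j) \<noteq> 0"
    obtain s u v where s: "1 \<le> s" "s < length ds" "u < blen ds s" "v < blen ds (Suc s)"
      "i = block_start ds s + u" "j = block_start ds (Suc s) + v"
      using graded_part_one_entry[OF X sum h(1,2,4)] by metis
    obtain t u' w where t: "1 \<le> t" "t < length ds" "u' < blen ds t" "w < blen ds (Suc t)"
      "k = block_start ds t + u'" "j = block_start ds (Suc t) + w"
      using graded_part_one_entry[OF X sum h(3,2,5)] by metis
    have "Suc t = Suc s" using block_of_eq[of "Suc s" ds v] block_of_eq[of "Suc t" ds w] s t by simp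
    then show "i = k" using rows[of s] c[of s] e[of s u v] e[of s u' v] s t h
      by (auto simp: unique_cols_def)
  qed
qed

text \<open>Rows of \<open>X\<close> through the first half of the blocks are rows of the prescribed
  rectangles; the remaining rows are mirror images of their columns. The orthogonal exception
  survives only for columns in the central block, which are met by the last rectangle of an odd
  number of blocks.\<close>

lemma simple_system_S1_iff:
  assumes T: "\<not> special_linear T" and bs: "block_sequence T ds"
  shows "simple_system T (S1 T ds) \<longleftrightarrow> (\<forall>s\<in>{1..length ds div 2}. unique_cols (rect T ds s) \<and>
    (if orthogonal_type T \<and> length ds = 2 * s + 1 then mirror_rows (rect T ds s)
     else unique_rows (rect T ds s)))"
    (is "_ \<longleftrightarrow> ?R")
proof -
  note sum = block_sequence_sum[OF bs] and X = X_R_graded[OF bs] and rev = block_sequence_rev[OF bs T]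
  note nr = num_rects_not_special_linear[OF T]
  define Z L where "Z = X_R T ds" and "L = length ds"
  have e: "Z $$ (block_start ds s + u, block_start ds (Suc s) + v) = rect T ds s $$ (u, v)"
    if "1 \<le> s" "s \<le> L div 2" "u < blen ds s" "v < blen ds (Suc s)" for s u v
    using X_R_entry[OF bs] that nr by (simp add: L_def Z_def)
  have c: "dim_row (rect T ds s) = blen ds s" "dim_col (rect T ds s) = blen ds (Suc s)"
    if "1 \<le> s" "s \<le> L div 2" for s
    using rect_carrier[OF bs that(1)] that nr by (auto simp: L_def)
  have Zl: "Z \<in> lie_alg T" using X by (simp add: graded_part_one_iff Z_def)
  have simple: "simple_system T (S1 T ds) \<longleftrightarrow>
    (\<forall>i<msize T. \<forall>j<msize T. \<forall>l<msize T.
      Z $$ (i, j) \<noteq> 0 \<and> Z $$ (i, l) \<noteq> 0 \<and> j \<noteq> l \<longrightarrow> orthogonal_type T \<and> l = opp T j)"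
    unfolding S1_def Z_def[symmetric]
    using graded_part_one_upper[OF X sum] Zl
    by (intro simple_system_involved_roots_iff[OF T]) (auto simp: Z_def)
  have lt: "block_start ds s + u < msize T" if "1 \<le> s" "s \<le> L" "u < blen ds s" for s u
    using block_start_add_less[of s ds u] that sum by (simp add: L_def)
  show ?thesis
    unfolding simple
  proof (intro iffI allI impI ballI)
    fix s
    assume h: "\<forall>i<msize T. \<forall>j<msize T. \<forall>l<msize T.
        Z $$ (i, j) \<noteq> 0 \<and> Z $$ (i, l) \<noteq> 0 \<and> j \<noteq> l \<longrightarrow> orthogonal_type T \<and> l = opp T j"
      and "s \<in> {1..length ds div 2}"
    then have s: "1 \<le> s" "s \<le> L div 2" by (auto simp: L_def)
    then have sL: "s \<le> L" "Suc s \<le> L" "1 \<le> Suc s" by auto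
    have "u = t" if "u < blen ds s" "t < blen ds s" "v < blen ds (Suc s)"
      "rect T ds s $$ (u, v) \<noteq> 0" "rect T ds s $$ (t, v) \<noteq> 0" for u t v
    proof (rule ccontr)
      assume ne: "u \<noteq> t"
      define i k j where "i = block_start ds s + u" and "k = block_start ds s + t"
        and "j = block_start ds (Suc s) + v"
      have b: "i < msize T" "k < msize T" "j < msize T"
        using lt s sL that by (auto simp: i_def k_def j_def)
      \<comment> \<open>Two entries of a column become two entries of a row. The exception would
        make \<open>i\<close> and \<open>k\<close> mirror images, but their block s <= L div 2 is
        not central.\<close>
      have "Z $$ (opp T j, opp T i) \<noteq> 0" "Z $$ (opp T j, opp T k) \<noteq> 0"
        using lie_alg_flip_nonzero[OF T Zl b(1,3)] lie_alg_flip_nonzero[OF T Zl b(2,3)]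
          e[OF s that(1,3)] e[OF s that(2,3)] that by (auto simp: i_def j_def k_def)
      moreover have "opp T i \<noteq> opp T k" using ne b by (simp add: i_def k_def)
      ultimately have "opp T k = opp T (opp T i)" using h b opp_less by metis
      then have "k = opp T i" using opp_inject[OF b(2) opp_less[OF b(1)]] by blast
      then have "block_of ds k = length ds + 1 - block_of ds i"
        using block_of_opp[OF rev sum b(1)] b by simp
      then show False
        using block_of_eq[of s ds u] block_of_eq[of s ds t] that s sL by (auto simp: i_def k_def L_def)
    qed
    then have cols: "unique_cols (rect T ds s)"
      by (simp add: unique_cols_def c[OF s])
    have rows: "v = w \<or> orthogonal_type T \<and> L = 2 * s + 1 \<and> w = blen ds (Suc s) - 1 - v"
      if "u < blen ds s" "v < blen ds (Suc s)" "w < blen ds (Suc s)"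
      "rect T ds s $$ (u, v) \<noteq> 0" "rect T ds s $$ (u, w) \<noteq> 0" for u v w
    proof (cases "v = w")
      case ne: False
      define i j l where "i = block_start ds s + u" and "j = block_start ds (Suc s) + v"
        and "l = block_start ds (Suc s) + w"
      have b: "i < msize T" "j < msize T" "l < msize T"
        using lt s sL that by (auto simp: i_def l_def j_def)
      have "Z $$ (i, j) \<noteq> 0" "Z $$ (i, l) \<noteq> 0" "j \<noteq> l"
        using e[OF s that(1,2)] e[OF s that(1,3)] that ne by (auto simp: i_def j_def l_def)
      then have o: "orthogonal_type T" "l = opp T j" using h b by blast+
      then have "block_of ds l = length ds + 1 - block_of ds j"
        using block_of_opp[OF rev sum b(2)] by simp
      then have L: "L = 2 * s + 1"
        using block_of_eq[of "Suc s" ds v] block_of_eq[of "Suc s" ds w] that s sL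
        by (auto simp: j_def l_def L_def)
      then have "l = block_start ds (Suc s) + (blen ds (Suc s) - 1 - v)"
        using o opp_block_start[OF rev sum, of "Suc s" v] that sL by (simp add: j_def L_def)
      then show ?thesis
        using o L by (simp add: l_def)
    qed simp
    show "unique_cols (rect T ds s) \<and>
        (if orthogonal_type T \<and> length ds = 2 * s + 1 then mirror_rows (rect T ds s)
         else unique_rows (rect T ds s))"
      using cols rows by (auto simp: unique_rows_def mirror_rows_def c[OF s] L_def)
  next
    fix i j l
    assume R: ?R and b: "i < msize T" "j < msize T" "l < msize T"
      and h: "Z $$ (i, j) \<noteq> 0 \<and> Z $$ (i, l) \<noteq> 0 \<and> j \<noteq> l"
    obtain s u v where s: "1 \<le> s" "s < L" "u < blen ds s" "v < blen ds (Suc s)"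
      "i = block_start ds s + u" "j = block_start ds (Suc s) + v"
      using graded_part_one_entry[OF X sum b(1,2)] h unfolding Z_def L_def by metis
    obtain t u' w where t: "1 \<le> t" "t < L" "u' < blen ds t" "w < blen ds (Suc t)"
      "i = block_start ds t + u'" "l = block_start ds (Suc t) + w"
      using graded_part_one_entry[OF X sum b(1,3)] h unfolding Z_def L_def by metis
    have ts: "t = s" using block_of_eq[of s ds u] block_of_eq[of t ds u'] s t by (simp add: L_def)
    then have "u' = u" using s t by simp
    show "orthogonal_type T \<and> l = opp T j"
    proof (cases "s \<le> L div 2")
      case True
      have nz: "rect T ds s $$ (u, v) \<noteq> 0" "rect T ds s $$ (u, w) \<noteq> 0" "v \<noteq> w"
        using e[of s u v] e[of s u w] h s t ts True by auto
      have R': "if orthogonal_type T \<and> L = 2 * s + 1 then mirror_rows (rect T ds s)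
         else unique_rows (rect T ds s)" using R s True by (simp add: L_def)
      have "\<not> unique_rows (rect T ds s)"
        using nz s t ts c[OF s(1) True] unfolding unique_rows_def by auto
      then have o: "orthogonal_type T" "L = 2 * s + 1" "mirror_rows (rect T ds s)"
        using R' by (auto split: if_splits)
      then have "w = blen ds (Suc s) - 1 - v"
        using nz s t ts c[OF s(1) True] unfolding mirror_rows_def by auto
      then have "l = opp T j"
        using opp_block_start[OF rev sum, of "Suc s" v] s t ts o by (simp add: L_def)
      then show ?thesis using o by simp
    next
      case False
      \<comment> \<open>The row lies in the second half, so its mirror image is a column of the
        prescribed rectangle number L - s.\<close>
      define s' where "s' = L - s"
      have s': "1 \<le> s'" "s' \<le> L div 2" "length ds + 1 - Suc s = s'" "length ds + 1 - s = Suc s'"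
        using False s by (auto simp: s'_def L_def)
      have bl: "blen ds s' = blen ds (Suc s)" "blen ds (Suc s') = blen ds s"
        using blen_opp[OF rev, of s] blen_opp[OF rev, of "Suc s"] s s' by (auto simp: L_def)
      have o: "opp T i = block_start ds (Suc s') + (blen ds s - 1 - u)"
        "opp T j = block_start ds s' + (blen ds (Suc s) - 1 - v)"
        "opp T l = block_start ds s' + (blen ds (Suc s) - 1 - w)"
        using opp_block_start[OF rev sum, of s u] opp_block_start[OF rev sum, of "Suc s" v]
          opp_block_start[OF rev sum, of "Suc s" w] s t s' ts by (auto simp: L_def)
      have "Z $$ (opp T j, opp T i) \<noteq> 0" "Z $$ (opp T l, opp T i) \<noteq> 0"
        using lie_alg_flip_nonzero[OF T Zl] b h by auto
      then have "rect T ds s' $$ (blen ds (Suc s) - 1 - v, blen ds s - 1 - u) \<noteq> 0"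
        "rect T ds s' $$ (blen ds (Suc s) - 1 - w, blen ds s - 1 - u) \<noteq> 0"
        using e[OF s'(1,2), of "blen ds (Suc s) - 1 - v" "blen ds s - 1 - u"]
          e[OF s'(1,2), of "blen ds (Suc s) - 1 - w" "blen ds s - 1 - u"] s t ts bl o by auto
      moreover have "unique_cols (rect T ds s')" using R s' by (simp add: L_def)
      ultimately have "blen ds (Suc s) - 1 - v = blen ds (Suc s) - 1 - w"
        by (intro unique_colsD[of "rect T ds s'" _ "blen ds s - 1 - u"])
          (use s t ts in \<open>auto simp: c[OF s'(1,2)] bl\<close>)
      then have "v = w" using s(4) t(4)[unfolded ts] by linarith
      then show ?thesis using h s t ts by simp
    qed
  qed
qed

section \<open>Consequences of niceness\<close>

text \<open>The equations become a square system by setting row \<open>m\<close> to zero, which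
  makes the determinant vanish.\<close>

lemma homogeneous_system_nonzero_solution:
  fixes f :: "nat \<Rightarrow> nat \<Rightarrow> complex"
  assumes "m < n"
  obtains x j where "j < n" "x j \<noteq> 0" "\<And>i. i < m \<Longrightarrow> (\<Sum>j<n. f i j * x j) = 0"
proof -
  define c where "c i = vec n (\<lambda>j. f i j)" for i
  define M where "M = mat\<^sub>r n n (\<lambda>i. if i = m then 0\<^sub>v n else c i)"
  have M: "M \<in> carrier_mat n n" by (simp add: M_def)
  have "det M = 0"
    unfolding M_def by (rule det_row_0) (use assms in \<open>auto simp: c_def\<close>)
  then obtain v where v: "v \<in> carrier_vec n" "v \<noteq> 0\<^sub>v n" "M *\<^sub>v v = 0\<^sub>v n"
    using det_0_iff_vec_prod_zero[OF M] by blast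
  obtain j where j: "j < n" "v $ j \<noteq> 0" using v(1,2) by (auto simp: vec_eq_iff)
  have "(\<Sum>j<n. f i j * v $ j) = 0" if "i < m" for i
  proof -
    have "(M *\<^sub>v v) $ i = 0" using v(3) that assms by simp
    moreover have "(M *\<^sub>v v) $ i = (\<Sum>j<n. f i j * v $ j)"
      using that assms v(1) by (simp add: M_def c_def scalar_prod_def atLeast0LessThan)
    ultimately show ?thesis by simp
  qed
  then show ?thesis using that[of j "\<lambda>j. v $ j"] j by blast
qed

section \<open>Kernel vectors of X supported in one block\<close>

lemma block_of_le: "p < sum_list ds \<Longrightarrow> block_of ds p \<le> length ds"
  using block_decomposition by metis

definition block_kernel :: "classical \<Rightarrow> nat list \<Rightarrow> complex mat \<Rightarrow> nat \<Rightarrow> (nat \<Rightarrow> complex) \<Rightarrow> bool" where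
  "block_kernel T ds X s v \<longleftrightarrow> (\<forall>q<msize T. v q \<noteq> 0 \<longrightarrow> block_of ds q = s) \<and>
    (\<forall>p<msize T. (\<Sum>q<msize T. X $$ (p, q) * v q) = 0)"

text \<open>\<open>X\<close> maps block s + 1 into block s, so a longer block s + 1 contains a
  kernel vector. A surplus beyond \<open>e\<close> > 0 leaves room to prescribe in addition that the
  vector vanishes at \<open>k\<close>, which later produces a second, independent one.\<close>

lemma block_kernel_exists:
  assumes X: "X \<in> graded_part T ds 1" and sum: "sum_list ds = msize T"
    and s: "1 \<le> s" "Suc s \<le> length ds" and less: "blen ds s + e < blen ds (Suc s)"
    and k: "k < msize T"
  obtains v q where "block_kernel T ds X (Suc s) v" "q < msize T" "v q \<noteq> 0" "0 < e \<Longrightarrow> v k = 0"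
proof -
  define a b S where "a = blen ds s" and "b = blen ds (Suc s)" and "S = block_start ds (Suc s)"
  \<comment> \<open>The rows from \<open>a\<close> on all repeat the one extra equation "coordinate
    \<open>k\<close> is 0"; it is trivial if \<open>k\<close> lies outside the block.\<close>
  define f where "f i j = (if i < a then X $$ (block_start ds s + i, S + j)
      else if S + j = k then 1 else 0)" for i j
  have "a + e < b" using less by (simp add: a_def b_def)
  then obtain x j where j: "j < b" "x j \<noteq> 0"
    and x: "\<And>i. i < a + e \<Longrightarrow> (\<Sum>j<b. f i j * x j) = 0"
    using homogeneous_system_nonzero_solution[of "a + e" b f] by metis
  define v where "v q = (if block_of ds q = Suc s then x (q - S) else 0)" for q
  have block: "block_of ds (S + j) = Suc s" "S + j < msize T" if "j < b" for j
    using block_of_eq[of "Suc s" ds j] block_start_add_less[of "Suc s" ds j] s that sum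
    by (auto simp: S_def b_def)
  have conv: "(\<Sum>q<msize T. g q * v q) = (\<Sum>j<b. g (S + j) * x j)" for g
  proof -
    have "(\<Sum>q<msize T. g q * v q) = (\<Sum>q\<in>(\<lambda>j. S + j) ` {..<b}. g q * v q)"
    proof (rule sum.mono_neutral_right)
      show "\<forall>q\<in>{..<msize T} - (\<lambda>j. S + j) ` {..<b}. g q * v q = 0"
      proof
        fix q assume q: "q \<in> {..<msize T} - (\<lambda>j. S + j) ` {..<b}"
        then obtain t u where "u < blen ds t" "q = block_start ds t + u" "block_of ds q = t"
          using block_decomposition[of q ds] sum by (metis DiffD1 lessThan_iff)
        then have "block_of ds q \<noteq> Suc s" using q by (auto simp: S_def b_def)
        then show "g q * v q = 0" by (simp add: v_def)
      qed
    qed (use block in auto)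
    also have "\<dots> = (\<Sum>j<b. g (S + j) * v (S + j))"
      by (subst sum.reindex) (auto simp: inj_on_def)
    also have "\<dots> = (\<Sum>j<b. g (S + j) * x j)"
      using block by (intro sum.cong) (auto simp: v_def)
    finally show ?thesis .
  qed
  have "(\<Sum>q<msize T. X $$ (p, q) * v q) = 0" if p: "p < msize T" for p
  proof (cases "block_of ds p = s")
    case True
    obtain t u where t: "u < blen ds t" "p = block_start ds t + u" "block_of ds p = t"
      using block_decomposition[of p ds] sum p by metis
    then have u: "u < a" "p = block_start ds s + u" using True by (auto simp: a_def)
    have "(\<Sum>q<msize T. X $$ (p, q) * v q) = (\<Sum>j<b. f u j * x j)"
      unfolding conv using u by (simp add: f_def)
    then show ?thesis using x[of u] u by simp
  next
    case False
    show ?thesis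
    proof (intro sum.neutral ballI)
      fix q assume q: "q \<in> {..<msize T}"
      show "X $$ (p, q) * v q = 0"
      proof (cases "X $$ (p, q) = 0")
        case nz: False
        then have "block_of ds q = Suc (block_of ds p)"
          using X p q unfolding graded_part_one_iff by blast
        then show ?thesis using False by (simp add: v_def)
      qed simp
    qed
  qed
  moreover have "v k = 0" if "0 < e"
  proof -
    have "(\<Sum>q<msize T. (if q = k then 1 else 0) * v q) = (\<Sum>q<msize T. if q = k then v q else 0)"
      by (intro sum.cong) auto
    then have "v k = (\<Sum>q<msize T. (if q = k then 1 else 0) * v q)"
      using k by simp
    also have "\<dots> = (\<Sum>j<b. f a j * x j)"
      unfolding conv by (simp add: f_def)
    also have "\<dots> = 0" using x[of a] that by simp
    finally show ?thesis .
  qed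
  moreover have "v (S + j) \<noteq> 0" using j block by (simp add: v_def)
  ultimately show ?thesis
    using that[of v "S + j"] block[OF j(1)] by (auto simp: block_kernel_def v_def)
qed

lemma lie_alg_flip':
  assumes "\<not> special_linear T" "A \<in> lie_alg T" "i < msize T" "j < msize T"
  shows "A $$ (i, j) = - tau T i * tau T j * A $$ (opp T j, opp T i)"
  using lie_alg_flip[OF assms] tau_cases[of T i] tau_cases[of T j] by auto

text \<open>The matrix \<open>Z = v w\<^sup>T F\<close>, where \<open>F\<close> is the matrix of the invariant form, commutes with \<open>X\<close>;
  by invariance of the trace form it is therefore orthogonal to the image of \<open>ad X\<close>.\<close>

lemma bracket_pairing_zero:
  assumes T: "\<not> special_linear T" and X: "X \<in> lie_alg T" and Y: "Y \<in> carrier_mat (msize T) (msize T)"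
    and v: "\<And>p. p < msize T \<Longrightarrow> (\<Sum>q<msize T. X $$ (p, q) * v q) = 0"
    and w: "\<And>p. p < msize T \<Longrightarrow> (\<Sum>q<msize T. X $$ (p, q) * w q) = 0"
  shows "(\<Sum>p<msize T. \<Sum>q<msize T. tau T p * w (opp T p) * bracket Y X $$ (p, q) * v q) = 0"
proof -
  let ?N = "msize T"
  define c where "c p = tau T p * w (opp T p)" for p
  have Xc: "X \<in> carrier_mat ?N ?N" using lie_alg_carrier[OF X] .
  \<comment> \<open>By the reflection rule, \<open>w\<close> in the kernel of \<open>X\<close>
    becomes a row vector \<open>c\<close> annihilated by \<open>X\<close> from the left.\<close>
  have cX: "(\<Sum>p<?N. c p * X $$ (p, k)) = 0" if k: "k < ?N" for k
  proof -
    have "c p * X $$ (p, k) = - tau T k * (X $$ (opp T k, opp T p) * w (opp T p))" if "p < ?N" for p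
      using lie_alg_flip'[OF T X that k] tau_cases[of T p] by (auto simp: c_def)
    then have "(\<Sum>p<?N. c p * X $$ (p, k)) =
        - tau T k * (\<Sum>p<?N. X $$ (opp T k, opp T p) * w (opp T p))"
      by (simp add: sum_distrib_left)
    also have "(\<Sum>p<?N. X $$ (opp T k, opp T p) * w (opp T p)) = (\<Sum>p<?N. X $$ (opp T k, p) * w p)"
      by (rule sum.reindex_bij_witness[of _ "opp T" "opp T"]) auto
    also have "\<dots> = 0" using w k by simp
    finally show ?thesis by simp
  qed
  have br: "bracket Y X $$ (p, q) = (\<Sum>k<?N. Y $$ (p, k) * X $$ (k, q)) - (\<Sum>k<?N. X $$ (p, k) * Y $$ (k, q))"
    if "p < ?N" "q < ?N" for p q
    using that Xc Y by (simp add: bracket_def scalar_prod_def atLeast0LessThan)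
  \<comment> \<open>The two halves of the bracket vanish separately: YX because it acts on
    \<open>v\<close>, XY because \<open>c\<close> acts on it.\<close>
  have "(\<Sum>p<?N. \<Sum>q<?N. c p * bracket Y X $$ (p, q) * v q) =
      (\<Sum>p<?N. \<Sum>q<?N. \<Sum>k<?N. c p * Y $$ (p, k) * (X $$ (k, q) * v q)) -
      (\<Sum>p<?N. \<Sum>q<?N. \<Sum>k<?N. c p * X $$ (p, k) * (Y $$ (k, q) * v q))"
    by (simp add: br sum_subtractf sum_distrib_left sum_distrib_right algebra_simps flip: sum_subtractf)
  also have "(\<Sum>p<?N. \<Sum>q<?N. \<Sum>k<?N. c p * Y $$ (p, k) * (X $$ (k, q) * v q)) =
      (\<Sum>p<?N. \<Sum>k<?N. c p * Y $$ (p, k) * (\<Sum>q<?N. X $$ (k, q) * v q))"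
    by (subst sum.swap[of _ "{..<?N}" "{..<?N}"]) (simp add: sum_distrib_left)
  also have "\<dots> = 0" using v by simp
  also have "(\<Sum>p<?N. \<Sum>q<?N. \<Sum>k<?N. c p * X $$ (p, k) * (Y $$ (k, q) * v q)) =
      (\<Sum>q<?N. \<Sum>k<?N. (\<Sum>p<?N. c p * X $$ (p, k)) * (Y $$ (k, q) * v q))"
    by (subst sum.swap, rule sum.cong[OF refl], subst sum.swap) (simp add: sum_distrib_right)
  also have "\<dots> = 0" using cX by simp
  finally show ?thesis by (simp add: c_def)
qed

lemma sum_pair_delta:
  fixes g :: "nat \<Rightarrow> nat \<Rightarrow> 'a :: comm_monoid_add"
  assumes "a < n" "b < n"
  shows "(\<Sum>p<n. \<Sum>q<n. if p = a \<and> q = b then g p q else 0) = g a b"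
proof -
  have "(\<Sum>q<n. if p = a \<and> q = b then g p q else 0) = (if p = a then g a b else 0)" for p
    using assms by (cases "p = a") simp_all
  then show ?thesis using assms by simp
qed

lemma root_vector_pairing:
  assumes T: "\<not> special_linear T" and b: "i < msize T" "j < msize T"
  shows "(\<Sum>p<msize T. \<Sum>q<msize T. c p * root_vector T i j $$ (p, q) * v q) = c i * v j +
    (if opp T j = i then 0 else - tau T i * tau T j * c (opp T j) * v (opp T i))"
proof -
  \<comment> \<open>Coefficient of the mirrored term, set to 0 on the skew-diagonal so that a
    self-mirrored position is not counted twice.\<close>
  define k where "k = (if opp T j = i then 0 else - tau T i * tau T j)"
  have ob: "opp T j < msize T" "opp T i < msize T" using b by auto
  have split: "x * e * y = (if A then x * y else 0) + (if B then k * x * y else 0)"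
    if "e = (if A then 1 else if B then z else 0)" "A \<Longrightarrow> B \<Longrightarrow> k = 0" "B \<Longrightarrow> \<not> A \<Longrightarrow> k = z"
    for A B and e x y z :: complex
    using that by (cases A; cases B) simp_all
  have "c p * root_vector T i j $$ (p, q) * v q = (if p = i \<and> q = j then c p * v q else 0) +
      (if p = opp T j \<and> q = opp T i then k * c p * v q else 0)"
    if pq: "p < msize T" "q < msize T" for p q
  proof (rule split[where z = "- tau T i * tau T j"])
    show "root_vector T i j $$ (p, q) =
        (if p = i \<and> q = j then 1 else if p = opp T j \<and> q = opp T i then - tau T i * tau T j else 0)"
      using pq T by (simp add: root_vector_def cong: if_cong split del: if_split)
    show "k = 0" if "p = i \<and> q = j" "p = opp T j \<and> q = opp T i"
      using that by (simp only: k_def simp_thms if_True)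
    show "k = - tau T i * tau T j" if "p = opp T j \<and> q = opp T i" "\<not> (p = i \<and> q = j)"
    proof -
      have "opp T j \<noteq> i" using that opp_eq_iff[OF b(2,1)] by metis
      then show ?thesis by (simp only: k_def if_False)
    qed
  qed
  then have "(\<Sum>p<msize T. \<Sum>q<msize T. c p * root_vector T i j $$ (p, q) * v q) = c i * v j +
      k * c (opp T j) * v (opp T i)"
    using sum_pair_delta[OF b, of "\<lambda>p q. c p * v q"] sum_pair_delta[OF ob, of "\<lambda>p q. k * c p * v q"]
    by (simp add: sum.distrib cong: if_cong split del: if_split)
  then show ?thesis by (simp add: k_def)
qed

section \<open>Restrictions that niceness puts on the kernel vectors\<close>

lemma root_vector_mem_nilradical:
  assumes T: "\<not> special_linear T" and bs: "block_sequence T ds" and ij: "root_pos T i j"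
    and less: "block_of ds i < block_of ds j"
  shows "root_vector T i j \<in> nilradical T ds"
proof -
  note rev = block_sequence_rev[OF bs T] and sum = block_sequence_sum[OF bs]
  have b: "i < msize T" "j < msize T" using ij by (auto simp: root_pos_def)
  have "block_of ds j \<le> length ds" using block_decomposition[of j ds] b sum by metis
  then have o: "block_of ds (opp T j) < block_of ds (opp T i)"
    using less block_of_opp[OF rev sum] b by simp
  have "block_of ds p < block_of ds q"
    if "p < msize T" "q < msize T" "root_vector T i j $$ (p, q) \<noteq> 0" for p q
    using that less o by (auto simp: root_vector_def split: if_splits)
  then show ?thesis using root_vector_mem_lie_alg[OF ij] by (simp add: nilradical_def)
qed

text \<open>The inequality says that the position (opp i, j) lies in the nilradical. By niceness its
  root vector is some [Y, X], so its pairing with \<open>v\<close> and \<open>w\<close> is 0; this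
  is a quadratic relation between coordinates \<open>i\<close> and \<open>j\<close>.\<close>

lemma nice_pairing:
  assumes T: "\<not> special_linear T" and bs: "block_sequence T ds" and X: "X \<in> graded_part T ds 1"
    and image: "(\<lambda>Y. bracket Y X) ` parabolic T ds = nilradical T ds"
    and v: "block_kernel T ds X s v" and w: "block_kernel T ds X t w"
    and ij: "root_pos T (opp T i) j" and i: "i < msize T"
    and less: "length ds + 1 < block_of ds i + block_of ds j"
  shows "tau T (opp T i) * w i * v j +
    (if opp T j = opp T i then 0 else - tau T (opp T i) * tau T j * (tau T (opp T j) * w j) * v i) = 0"
proof -
  note rev = block_sequence_rev[OF bs T] and sum = block_sequence_sum[OF bs]
  have j: "j < msize T" using ij by (simp add: root_pos_def)
  have "block_of ds (opp T i) < block_of ds j"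
    using less block_of_opp[OF rev sum i] block_of_le[of i ds] i sum by simp
  then have "root_vector T (opp T i) j \<in> nilradical T ds"
    using root_vector_mem_nilradical[OF T bs ij] by simp
  then obtain Y where Y: "Y \<in> parabolic T ds" "root_vector T (opp T i) j = bracket Y X"
    using image by blast
  have Yc: "Y \<in> carrier_mat (msize T) (msize T)"
    using Y(1) lie_alg_carrier by (auto simp: parabolic_def)
  have Xl: "X \<in> lie_alg T" using X by (simp add: graded_part_one_iff)
  have pairing: "(\<Sum>p<msize T. \<Sum>q<msize T. tau T p * w (opp T p) * bracket Y X $$ (p, q) * v q) = 0"
    using v w by (intro bracket_pairing_zero[OF T Xl Yc]) (auto simp: block_kernel_def)
  show ?thesis
    using pairing[folded Y(2), unfolded root_vector_pairing[OF T opp_less[OF i] j, of "\<lambda>p. tau T p * w (opp T p)" v]]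
    by (simp only: opp_opp[OF i] opp_opp[OF j])
qed

text \<open>The skew-diagonal position (opp j, j) carries a long root of sp. With \<open>w\<close> =
  \<open>v\<close> the relation of \<open>nice_pairing\<close> is just that the square of
  \<open>v j\<close> is 0.\<close>

lemma nice_kernel_symplectic:
  assumes T: "\<not> special_linear T" "\<not> orthogonal_type T" and bs: "block_sequence T ds"
    and X: "X \<in> graded_part T ds 1"
    and image: "(\<lambda>Y. bracket Y X) ` parabolic T ds = nilradical T ds"
    and v: "block_kernel T ds X s v" and s: "length ds + 1 < 2 * s" and j: "j < msize T"
  shows "v j = 0"
proof (rule ccontr)
  assume nz: "v j \<noteq> 0"
  then have b: "block_of ds j = s" using v j by (simp add: block_kernel_def)
  have "block_of ds (opp T j) \<noteq> block_of ds j"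
    using block_of_opp[OF block_sequence_rev[OF bs T(1)] block_sequence_sum[OF bs] j] b s by simp
  then have "root_pos T (opp T j) j" using T j by (auto simp: root_pos_def)
  then show False using nice_pairing[OF T(1) bs X image v v _ j, where j = j] b s nz by simp
qed

text \<open>Without skew-diagonal roots one kernel vector gives no contradiction, but two
  independent ones do: if \<open>w j\<close> = 0, the relation reduces to \<open>w i * v j\<close> =
  0. Kernel vectors in different blocks are of this kind, having disjoint supports.\<close>

lemma nice_kernel_orthogonal:
  assumes T: "orthogonal_type T" and bs: "block_sequence T ds" and X: "X \<in> graded_part T ds 1"
    and image: "(\<lambda>Y. bracket Y X) ` parabolic T ds = nilradical T ds"
    and v: "block_kernel T ds X s v" "j < msize T" "v j \<noteq> 0"
    and w: "block_kernel T ds X t w" "i < msize T" "w i \<noteq> 0"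
    and st: "length ds + 1 < s + t"
  shows "s = t \<and> w j \<noteq> 0"
proof (rule ccontr)
  assume h: "\<not> (s = t \<and> w j \<noteq> 0)"
  note T' = orthogonal_not_special_linear[OF T]
  have b: "block_of ds j = s" "block_of ds i = t" using v w by (auto simp: block_kernel_def)
  then have wj: "w j = 0" using h v w by (auto simp: block_kernel_def)
  then have ne: "i \<noteq> j" using w by auto
  have "block_of ds (opp T i) \<noteq> block_of ds j"
    using block_of_opp[OF block_sequence_rev[OF bs T'] block_sequence_sum[OF bs] w(2)] b st
      block_of_le[of i ds] w(2) block_sequence_sum[OF bs] by simp
  then have "root_pos T (opp T i) j" using ne v w by (auto simp: root_pos_def)
  then show False
    using nice_pairing[OF T' bs X image v(1) w(1) _ w(2), where j = j] b st v w wj ne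
    by (auto simp: tau_orthogonal split: if_splits)
qed

text \<open>A drop after block i is, mirrored, a rise from block L - i to block L + 1 - i, so
  \<open>X\<close> has a kernel vector in the latter, which lies beyond the middle.\<close>

lemma nice_symplectic_mono:
  assumes T: "\<not> special_linear T" "\<not> orthogonal_type T" and bs: "block_sequence T ds"
    and nice: "nice T ds" and i: "1 \<le> i" "i \<le> length ds div 2"
  shows "blen ds i \<le> blen ds (Suc i)"
proof (rule ccontr)
  assume drop: "\<not> blen ds i \<le> blen ds (Suc i)"
  note rev = block_sequence_rev[OF bs T(1)] and sum = block_sequence_sum[OF bs]
  obtain X where X: "X \<in> graded_part T ds 1"
    and image: "(\<lambda>Y. bracket Y X) ` parabolic T ds = nilradical T ds"
    using nice by (auto simp: nice_def)
  define s where "s = length ds - i"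
  have s: "1 \<le> s" "Suc s \<le> length ds" "Suc s = length ds + 1 - i" "s = length ds + 1 - Suc i"
    "length ds + 1 < 2 * Suc s"
    using i by (auto simp: s_def)
  have "blen ds s = blen ds (Suc i)" "blen ds (Suc s) = blen ds i"
    using blen_opp[OF rev, of i] blen_opp[OF rev, of "Suc i"] s i by auto
  then have less: "blen ds s + 0 < blen ds (Suc s)" using drop by simp
  then have "0 < blen ds (Suc s)" by simp
  then have "block_start ds (Suc s) + 0 < msize T"
    using block_start_add_less[of "Suc s" ds 0] s sum by simp
  then obtain v q where "block_kernel T ds X (Suc s) v" "q < msize T" "v q \<noteq> 0"
    using block_kernel_exists[OF X sum s(1,2) less] by metis
  then show False using nice_kernel_symplectic[OF T bs X image _ s(5)] by blast
qed

text \<open>The drop at \<open>l\<close> gives a kernel vector in block L + 1 - l. A drop by two or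
  more gives a second one, vanishing where the first does not. A later drop or rise at
  \<open>m\<close> gives one in block L + 1 - m or m + 1. In each case the two block numbers add up
  to more than L + 1.\<close>

lemma nice_orthogonal_drop:
  assumes T: "orthogonal_type T" and bs: "block_sequence T ds" and nice: "nice T ds"
    and odd: "odd (length ds)" and l: "1 \<le> l" "l \<le> length ds div 2"
    and drop: "blen ds l > blen ds (Suc l)"
  shows "blen ds l = blen ds (Suc l) + 1 \<and>
    (\<forall>m. l < m \<and> m \<le> length ds div 2 \<longrightarrow> blen ds m = blen ds (Suc m))"
proof -
  note T' = orthogonal_not_special_linear[OF T]
  note rev = block_sequence_rev[OF bs T'] and sum = block_sequence_sum[OF bs]
  obtain X where X: "X \<in> graded_part T ds 1"
    and image: "(\<lambda>Y. bracket Y X) ` parabolic T ds = nilradical T ds"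
    using nice by (auto simp: nice_def)
  have kernel: "\<exists>v q. block_kernel T ds X (length ds + 1 - m) v \<and> q < msize T \<and> v q \<noteq> 0 \<and>
      (0 < e \<longrightarrow> v k = 0)"
    if m: "1 \<le> m" "m \<le> length ds div 2" and d: "blen ds (Suc m) + e < blen ds m"
      and k: "k < msize T" for m e k
  proof -
    define s where "s = length ds - m"
    have s: "1 \<le> s" "Suc s \<le> length ds" "Suc s = length ds + 1 - m" "s = length ds + 1 - Suc m"
      using m by (auto simp: s_def)
    have "blen ds s = blen ds (Suc m)" "blen ds (Suc s) = blen ds m"
      using blen_opp[OF rev, of m] blen_opp[OF rev, of "Suc m"] s m by auto
    then have less: "blen ds s + e < blen ds (Suc s)" using d by simp
    then obtain v q where "block_kernel T ds X (Suc s) v" "q < msize T" "v q \<noteq> 0" "0 < e \<Longrightarrow> v k = 0"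
      using block_kernel_exists[OF X sum s(1,2) less k] by metis
    then show ?thesis unfolding s(3) by blast
  qed
  have "0 < blen ds l" "l \<le> length ds" using drop l by linarith+
  then have pos: "0 < msize T"
    using block_start_add_less[of l ds 0] l sum by (cases "msize T") auto
  obtain v j where v: "block_kernel T ds X (length ds + 1 - l) v" "j < msize T" "v j \<noteq> 0"
    using kernel[OF l _ pos, of 0] drop by auto
  have 1: "blen ds l = blen ds (Suc l) + 1"
  proof (rule ccontr)
    assume "blen ds l \<noteq> blen ds (Suc l) + 1"
    then have "blen ds (Suc l) + 1 < blen ds l" using drop by simp
    then obtain w i where "block_kernel T ds X (length ds + 1 - l) w" "i < msize T" "w i \<noteq> 0" "w j = 0"
      using kernel[OF l _ v(2), of 1] by auto
    then show False
      using nice_kernel_orthogonal[OF T bs X image v, of _ w i] l by force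
  qed
  have 2: "blen ds m = blen ds (Suc m)" if m: "l < m" "m \<le> length ds div 2" for m
  proof (rule ccontr)
    assume ne: "blen ds m \<noteq> blen ds (Suc m)"
    obtain t w i where w: "block_kernel T ds X t w" "i < msize T" "w i \<noteq> 0"
      and t: "length ds + 1 < (length ds + 1 - l) + t" "length ds + 1 - l \<noteq> t"
    proof (cases "blen ds (Suc m) < blen ds m")
      case True
      then obtain w i where "block_kernel T ds X (length ds + 1 - m) w" "i < msize T" "w i \<noteq> 0"
        using kernel[OF _ m(2) _ pos, of 0] m l by auto
      then show ?thesis using that m l odd by (auto elim!: oddE)
    next
      case False
      then have "blen ds m + 0 < blen ds (Suc m)" using ne by simp
      moreover have "1 \<le> m" "Suc m \<le> length ds" using m l by linarith+
      ultimately obtain w i where "block_kernel T ds X (Suc m) w" "i < msize T" "w i \<noteq> 0"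
        using block_kernel_exists[OF X sum _ _ _ pos, of m 0] by metis
      then show ?thesis using that m l odd by (auto elim!: oddE)
    qed
    show False using nice_kernel_orthogonal[OF T bs X image v w t(1)] t(2) by blast
  qed
  show ?thesis using 1 2 by blast
qed

section \<open>The rectangles of \<open>X\<^sub>R\<close>\<close>

lemma J_at_iff: "(p, q) \<in> J_at u v m \<longleftrightarrow> u < p \<and> p \<le> u + m \<and> p + q = u + v + m + 1"
proof
  assume h: "u < p \<and> p \<le> u + m \<and> p + q = u + v + m + 1"
  then show "(p, q) \<in> J_at u v m"
    unfolding J_at_def by (intro CollectI exI[of _ "p - u"]) auto
qed (auto simp: J_at_def)

lemma ones_mat_nonzero:
  "u < a \<Longrightarrow> v < b \<Longrightarrow> ones_mat a b S $$ (u, v) \<noteq> 0 \<longleftrightarrow> (u + 1, v + 1) \<in> S"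
  by (simp add: ones_mat_def)

text \<open>Counted from 0, the upper right J lies on the antidiagonal u + v + 1 = b and the lower
  left J on u + v + 1 = a.\<close>

lemma corners_nonzero:
  assumes "u < a" "v < b" "k \<le> b" "m \<le> a"
  shows "corners a b k m $$ (u, v) \<noteq> 0 \<longleftrightarrow>
    (u < k \<and> u + v + 1 = b) \<or> (a \<le> u + m \<and> u + v + 1 = a)"
  using assms unfolding corners_def by (simp add: ones_mat_nonzero J_at_iff) linarith

lemma dim_ones_mat [simp]: "dim_row (ones_mat a b S) = a" "dim_col (ones_mat a b S) = b"
  by (simp_all add: ones_mat_def)

lemma dim_corners [simp]: "dim_row (corners a b k m) = a" "dim_col (corners a b k m) = b"
  by (simp_all add: corners_def)

lemma unique_ones_mat_J_at:
  "unique_rows (ones_mat a b (J_at u v m))" "unique_cols (ones_mat a b (J_at u v m))"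
  by (auto simp: unique_rows_def unique_cols_def ones_mat_nonzero J_at_iff)

lemma unique_rect_A: "unique_rows (rect_A ds i)" "unique_cols (rect_A ds i)"
  by (simp_all add: rect_A_def Let_def unique_ones_mat_J_at)

lemma unique_J_mat: "unique_rows (J_mat a)" "unique_cols (J_mat a)"
  by (auto simp: unique_rows_def unique_cols_def J_mat_def split: if_splits)

text \<open>\<open>k + m \<le> a\<close> keeps the row ranges of the two J's disjoint; the bound by
  \<open>b\<close> does the same for columns in the next lemma.\<close>

lemma unique_rows_corners:
  assumes "k + m \<le> a" "k \<le> b"
  shows "unique_rows (corners a b k m)"
  using assms by (auto simp: unique_rows_def corners_nonzero)

lemma unique_cols_corners:
  assumes "m \<le> a" "k + m \<le> b"
  shows "unique_cols (corners a b k m)"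
  using assms by (auto simp: unique_cols_def corners_nonzero)

lemma mirror_rows_if_unique_rows: "unique_rows R \<Longrightarrow> mirror_rows R"
  by (auto simp: unique_rows_def mirror_rows_def)

text \<open>The entries 1 and -1 lie on two antidiagonals that are two steps apart, and a parity
  tells which one an entry is on. Entries in one line from both would have to differ in parity and
  by 2 at once.\<close>

lemma central_square_BD_nonzero:
  assumes "u < a" "v < a" "central_square_BD i a $$ (u, v) \<noteq> 0"
  shows "if odd i then (u + v + 2 = a \<and> even v) \<or> (u + v = a \<and> odd v)
    else (u + v + 2 = a \<and> even u) \<or> (u + v = a \<and> odd u)"
proof -
  let ?P = "\<exists>k\<in>{1..a div 2}. (u + 1, v + 1) =
      (if odd i then (a + 1 - 2 * k, 2 * k - 1) else (2 * k - 1, a + 1 - 2 * k))"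
  let ?M = "\<exists>k\<in>{1..a div 2}. (u + 1, v + 1) =
      (if odd i then (a + 2 - 2 * k, 2 * k) else (2 * k, a + 2 - 2 * k))"
  have "central_square_BD i a $$ (u, v) = (if ?P then 1 else if ?M then - 1 else 0)"
    using assms(1,2) by (simp add: central_square_BD_def)
  then have "?P \<or> ?M" using assms(3) by metis
  then obtain k where k: "k \<in> {1..a div 2}" "(u + 1, v + 1) =
          (if odd i then (a + 1 - 2 * k, 2 * k - 1) else (2 * k - 1, a + 1 - 2 * k)) \<or>
      (u + 1, v + 1) =
          (if odd i then (a + 2 - 2 * k, 2 * k) else (2 * k, a + 2 - 2 * k))" by blast
  then have k': "1 \<le> k" "2 * k \<le> a" by auto
  show ?thesis
  proof (cases "odd i")
    case True
    then have "(u + 2 * k = a \<and> v + 2 = 2 * k) \<or> (u + 2 * k = a + 1 \<and> v + 1 = 2 * k)"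
      using k(2) k' by auto
    then show ?thesis unfolding if_P[OF True] by presburger
  next
    case False
    then have "(v + 2 * k = a \<and> u + 2 = 2 * k) \<or> (v + 2 * k = a + 1 \<and> u + 1 = 2 * k)"
      using k(2) k' by auto
    then show ?thesis unfolding if_not_P[OF False] by presburger
  qed
qed

lemma unique_central_square_BD:
  "unique_rows (central_square_BD i a)" "unique_cols (central_square_BD i a)"
proof -
  have d: "dim_row (central_square_BD i a) = a" "dim_col (central_square_BD i a) = a"
    by (simp_all add: central_square_BD_def)
  have "v = w" if "u < a" "v < a" "w < a" "central_square_BD i a $$ (u, v) \<noteq> 0"
      "central_square_BD i a $$ (u, w) \<noteq> 0" for u v w
    using central_square_BD_nonzero[OF that(1,2,4)] central_square_BD_nonzero[OF that(1,3,5)]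
    by (cases "odd i"; simp; presburger)
  then show "unique_rows (central_square_BD i a)" by (simp add: unique_rows_def d)
  have "u = t" if "u < a" "t < a" "v < a" "central_square_BD i a $$ (u, v) \<noteq> 0"
      "central_square_BD i a $$ (t, v) \<noteq> 0" for u t v
    using central_square_BD_nonzero[OF that(1,3,4)] central_square_BD_nonzero[OF that(2,3,5)]
    by (cases "odd i"; simp; presburger)
  then show "unique_cols (central_square_BD i a)" by (simp add: unique_cols_def d)
qed

section \<open>The rectangles that violate the criterion, and the form with a star\<close>

definition single_drop :: "nat list \<Rightarrow> bool" where
  "single_drop ds \<longleftrightarrow> (\<forall>l. 1 \<le> l \<and> l \<le> length ds div 2 \<and> blen ds l > blen ds (l + 1) \<longrightarrow>
     blen ds l = blen ds (l + 1) + 1 \<and>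
     (\<forall>m. l < m \<and> m \<le> length ds div 2 \<longrightarrow> blen ds m = blen ds (m + 1)))"

text \<open>A drop from odd to even makes the J's clash in a column, which nothing excuses. A rise
  makes them clash in the middle row only; this is excused in the last rectangle and avoided in the
  exceptional one.\<close>

definition bad_rect :: "nat list \<Rightarrow> nat \<Rightarrow> bool" where
  "bad_rect ds s \<longleftrightarrow> odd (blen ds s) \<and> even (blen ds (s + 1)) \<and>
    (blen ds s > blen ds (s + 1) \<or> s < length ds div 2 \<and>
      \<not> (odd (sum_list ds) \<and> blen ds (s + 1) > blen ds (s + 2) \<and> blen ds s = blen ds (s + 2)))"

text \<open>Corner blocks of sizes k and m avoid each other when k + m is at most \<open>a\<close>
  and at most \<open>b\<close>, and the cases compare these numbers. For odd \<open>a\<close> two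
  full blocks have total size a + 1, one too many.\<close>

lemma rect_BD_simple_iff:
  assumes odd: "odd (length ds)" and s: "1 \<le> s" "s \<le> length ds div 2"
    and sd: "single_drop ds" and pos: "0 < blen ds (s + 1)"
  shows "unique_cols (rect_BD ds s) \<and>
    (if length ds = 2 * s + 1 then mirror_rows (rect_BD ds s) else unique_rows (rect_BD ds s)) \<longleftrightarrow>
    \<not> bad_rect ds s"
proof -
  define a b r where "a = blen ds s" and "b = blen ds (s + 1)" and "r = length ds div 2"
  have L: "length ds = 2 * s + 1 \<longleftrightarrow> s = r" using odd by (auto simp: r_def elim!: oddE)
  have b: "0 < b" using pos by (simp add: b_def)
  have ab: "a \<le> b + 1"
  proof (cases "b < a")
    case True
    then have "a = b + 1"
      using sd s unfolding single_drop_def a_def b_def by blast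
    then show ?thesis by simp
  qed simp
  have half: "half_up a = (a + 1) div 2" by (simp add: half_up_def)
  have good: "unique_cols R \<and> (if length ds = 2 * s + 1 then mirror_rows R else unique_rows R)"
    if "unique_cols R" "unique_rows R" for R
    using that mirror_rows_if_unique_rows by simp
  have corners: "unique_cols (corners a b k m)" "unique_rows (corners a b k m)"
    if "k + m \<le> a" "k + m \<le> b" for k m
    using that unique_rows_corners[of k m a b] unique_cols_corners[of m a k b] by auto
  define E where "E \<longleftrightarrow> odd (sum_list ds) \<and> s + 1 \<le> r \<and> b > blen ds (s + 2) \<and> odd a \<and> a = blen ds (s + 2)"
  have rect: "rect_BD ds s =
     (if E then (if odd s then corners a b (a div 2) (half_up a) else corners a b (half_up a) (a div 2))
      else if even a \<longleftrightarrow> even b then ones_mat a b (J_at 0 ((b - a) div 2) a)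
      else if a = b + 1 \<and> even a
      then (if odd s then corners a b (half_up a - 1) (half_up a)
           else corners a b (half_up a) (half_up a - 1))
      else corners a b (half_up a) (half_up a))"
    using odd by (simp only: rect_BD_def Let_def a_def b_def r_def E_def if_False)
  have bad: "bad_rect ds s \<longleftrightarrow> odd a \<and> even b \<and> (a > b \<or> s < r \<and>
      \<not> (odd (sum_list ds) \<and> b > blen ds (s + 2) \<and> a = blen ds (s + 2)))"
    by (simp only: bad_rect_def a_def b_def r_def)
  consider (E) E | (parity) "\<not> E" "even a \<longleftrightarrow> even b"
    | (drop) "\<not> E" "a = b + 1" "even a" "odd b"
    | (even) "\<not> E" "even a" "odd b" "a < b"
    | (odd_drop) "\<not> E" "odd a" "even b" "a = b + 1"
    | (odd_rise) "\<not> E" "odd a" "even b" "a < b"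
    using ab by (cases "a < b"; cases "a = b"; cases "a = b + 1") auto
  then show ?thesis
  proof cases
    case E
    \<comment> \<open>\<open>single_drop\<close> at block s + 1 turns the exceptional case into b =
      a + 1, so two J's of total size \<open>a\<close> fit.\<close>
    have "s + 1 + 1 = s + 2" by simp
    then have "1 \<le> s + 1 \<and> s + 1 \<le> length ds div 2 \<and> blen ds (s + 1) > blen ds (s + 1 + 1)"
      using E by (simp only: E_def b_def r_def) simp
    then have "blen ds (s + 1) = blen ds (s + 1 + 1) + 1"
      using sd unfolding single_drop_def by blast
    moreover have "a = blen ds (s + 1 + 1)" using E by (simp only: E_def) simp
    ultimately have "a < b" unfolding b_def by linarith
    have "a div 2 + half_up a = a" unfolding half by presburger
    with \<open>a < b\<close> have "a div 2 + half_up a \<le> a" "a div 2 + half_up a \<le> b" by linarith+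
    then have R: "unique_cols (corners a b (a div 2) (half_up a))"
      "unique_rows (corners a b (a div 2) (half_up a))"
      "unique_cols (corners a b (half_up a) (a div 2))"
      "unique_rows (corners a b (half_up a) (a div 2))"
      using corners[of "a div 2" "half_up a"] corners[of "half_up a" "a div 2"] by simp_all
    have "rect_BD ds s =
        (if odd s then corners a b (a div 2) (half_up a) else corners a b (half_up a) (a div 2))"
      using E by (simp only: rect if_True)
    then have "unique_cols (rect_BD ds s)" "unique_rows (rect_BD ds s)"
      using R by simp_all
    moreover have "\<not> bad_rect ds s"
      unfolding bad using E \<open>a < b\<close> unfolding E_def by linarith
    ultimately show ?thesis using good by simp
  next
    case parity
    then have "\<not> bad_rect ds s" by (auto simp: bad)
    moreover have "rect_BD ds s = ones_mat a b (J_at 0 ((b - a) div 2) a)"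
      by (simp only: rect parity simp_thms if_True if_False)
    ultimately show ?thesis using good unique_ones_mat_J_at by simp
  next
    case drop
    then have "\<not> bad_rect ds s" by (simp add: bad)
    moreover have "half_up a - 1 + half_up a \<le> b" unfolding half using drop(2,4) by presburger
    then have "unique_cols (rect_BD ds s)" "unique_rows (rect_BD ds s)"
      using drop corners[of "half_up a - 1" "half_up a"] corners[of "half_up a" "half_up a - 1"]
      by (auto simp: rect)
    ultimately show ?thesis using good by simp
  next
    case even
    then have "\<not> bad_rect ds s" by (auto simp: bad)
    moreover have "half_up a + half_up a \<le> a" unfolding half using even(2) by presburger
    then have "unique_cols (rect_BD ds s)" "unique_rows (rect_BD ds s)"
      using even corners[of "half_up a" "half_up a"] by (auto simp: rect)
    ultimately show ?thesis using good by simp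
  next
    case odd_drop
    then have R: "rect_BD ds s = corners a b (half_up a) (half_up a)" by (auto simp: rect)
    obtain c where c: "b = 2 * c" "0 < c" using odd_drop b by (auto elim!: evenE)
    then have h: "half_up a = c + 1" unfolding half using odd_drop(4) by presburger
    \<comment> \<open>With b = 2c and a = 2c + 1, column c - 1 meets the upper right J in row c and
      the lower left J in row c + 1.\<close>
    have "corners a b (c + 1) (c + 1) $$ (c, c - 1) \<noteq> 0"
      "corners a b (c + 1) (c + 1) $$ (c + 1, c - 1) \<noteq> 0"
      using c odd_drop corners_nonzero[of c a "c - 1" b "c + 1" "c + 1"]
        corners_nonzero[of "c + 1" a "c - 1" b "c + 1" "c + 1"] by auto
    then have "\<not> unique_cols (corners a b (c + 1) (c + 1))"
      using unique_colsD[of "corners a b (c + 1) (c + 1)" c "c - 1" "c + 1"] c odd_drop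
        less_imp_diff_less[of c b 1] by auto
    moreover have "bad_rect ds s" using odd_drop by (simp add: bad)
    ultimately show ?thesis by (simp add: R h)
  next
    case odd_rise
    then have R: "rect_BD ds s = corners a b (half_up a) (half_up a)" by (auto simp: rect)
    obtain c where c: "a = 2 * c + 1" using odd_rise by (auto elim!: oddE)
    then have h: "half_up a = c + 1" unfolding half by presburger
    have cb: "2 * c + 2 \<le> b" using c odd_rise by simp
    have cols: "unique_cols (rect_BD ds s)"
      unfolding R h using c cb by (intro unique_cols_corners) auto
    have nz: "corners a b (c + 1) (c + 1) $$ (u, v) \<noteq> 0 \<longleftrightarrow>
        (u \<le> c \<and> u + v + 1 = b) \<or> (c \<le> u \<and> u + v = 2 * c)" if "u < a" "v < b" for u v
      using corners_nonzero[OF that, of "c + 1" "c + 1"] c cb that by auto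
    show ?thesis
    proof (cases "s = r")
      case True
      then have "\<not> bad_rect ds s" unfolding bad using odd_rise by simp
      moreover have "mirror_rows (rect_BD ds s)"
        unfolding R h mirror_rows_def dim_corners
      proof (intro allI impI)
        fix u v w assume "u < a" "v < b" "w < b"
          "corners a b (c + 1) (c + 1) $$ (u, v) \<noteq> 0 \<and> corners a b (c + 1) (c + 1) $$ (u, w) \<noteq> 0"
        then show "v = w \<or> w = b - 1 - v" using nz[of u v] nz[of u w] by auto
      qed
      ultimately show ?thesis using cols True L by simp
    next
      case False
      \<comment> \<open>Both J's meet the middle row c, in the columns c and b - c - 1. These are
        mirror images, but the column block is not the central one here.\<close>
      have "corners a b (c + 1) (c + 1) $$ (c, c) \<noteq> 0"
        "corners a b (c + 1) (c + 1) $$ (c, b - c - 1) \<noteq> 0" "c \<noteq> b - c - 1"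
        using nz[of c c] nz[of c "b - c - 1"] c cb by auto
      moreover have "c < a" "c < b" "b - c - 1 < b" using c cb by linarith+
      ultimately have "\<not> unique_rows (rect_BD ds s)"
        unfolding R h using unique_rowsD[of "corners a b (c + 1) (c + 1)" c c "b - c - 1"]
        by (simp only: dim_corners) blast
      moreover have "bad_rect ds s"
        using odd_rise False s by (auto simp: bad E_def r_def)
      ultimately show ?thesis using False L by simp
    qed
  qed
qed

text \<open>A step in the first half of a palindrome lies either in the increasing part or,
  mirrored, in the decreasing part.\<close>

lemma unimodal_iff:
  assumes rev: "rev ds = ds" and L: "length ds = 2 * r + 1"
  shows "unimodal ds \<longleftrightarrow> (\<forall>l. 1 \<le> l \<and> l \<le> r \<longrightarrow> blen ds l \<le> blen ds (l + 1))"
proof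
  assume "unimodal ds"
  then obtain xs ys where ds: "ds = xs @ ys" and xs: "sorted xs" and ys: "sorted (rev ys)"
    by (auto simp: unimodal_def)
  show "\<forall>l. 1 \<le> l \<and> l \<le> r \<longrightarrow> blen ds l \<le> blen ds (l + 1)"
  proof (intro allI impI)
    fix l assume l: "1 \<le> l \<and> l \<le> r"
    show "blen ds l \<le> blen ds (l + 1)"
    proof (cases "l < length xs")
      case True
      then have "xs ! (l - 1) \<le> xs ! l" using xs by (intro sorted_nth_mono) auto
      then show ?thesis
        using True l less_imp_diff_less[of l "length xs" 1] by (simp add: blen_def ds nth_append)
    next
      case False
      \<comment> \<open>List index k, counted from 0, is the mirror of block l, and k - 1 is the
        mirror of block l + 1.\<close>
      define k where "k = length ds - l"
      have k: "l < k" "k \<le> length ds" using l L by (auto simp: k_def)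
      have "ys ! (k - length xs) \<le> ys ! (k - 1 - length xs)"
        by (rule sorted_rev_nth_mono[OF ys]) (use k l False ds in \<open>auto simp: k_def\<close>)
      moreover have "length xs \<le> k - 1" "length xs \<le> k" using k False by linarith+
      ultimately have "ds ! k \<le> ds ! (k - 1)" by (simp add: ds nth_append)
      moreover have "ds ! k = blen ds l" "ds ! (k - 1) = blen ds (l + 1)"
        using blen_opp[OF rev, of l] blen_opp[OF rev, of "l + 1"] l L by (auto simp: blen_def k_def)
      ultimately show ?thesis by simp
    qed
  qed
next
  assume mono: "\<forall>l. 1 \<le> l \<and> l \<le> r \<longrightarrow> blen ds l \<le> blen ds (l + 1)"
  have "ds ! i \<le> ds ! Suc i" if "Suc i < r + 1" for i
    using mono[rule_format, of "Suc i"] that by (simp add: blen_def)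
  then have s: "sorted (take (r + 1) ds)"
    using L by (auto simp: sorted_iff_nth_Suc)
  have "rev (drop (r + 1) ds) = take r ds"
    using take_rev[of r ds] rev L by simp
  moreover have "sorted (take r ds)"
    using s sorted_wrt_take[of "(\<le>)" "take (r + 1) ds" r] by (simp add: min_def)
  ultimately show "unimodal ds"
    unfolding unimodal_def using s
    by (intro exI[of _ "take (r + 1) ds"] exI[of _ "drop (r + 1) ds"]) simp
qed

text \<open>The delicate case is the rise from odd a_{l-1} to even a_l just before the drop. As a_l
  = a_{l+1} + 1, it forces a_{l-1} <= a_{l+1}. Equality makes a_{l+1}, hence the central block and
  N, odd, so the exceptional rectangle is in force; strict inequality is what
  \<open>form_star\<close> asks for.\<close>

lemma form_star_iff_bad_rect:
  assumes rev: "rev ds = ds" and L: "length ds = 2 * r + 1" and sd: "single_drop ds"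
  shows "form_star ds \<longleftrightarrow> (\<exists>s\<in>{1..r}. bad_rect ds s)"
proof -
  define a where "a = blen ds"
  have r: "length ds div 2 = r" using L by simp
  have drop: "a l = a (l + 1) + 1" "\<And>m. l < m \<Longrightarrow> m \<le> r \<Longrightarrow> a m = a (m + 1)"
    if "1 \<le> l" "l \<le> r" "a l > a (l + 1)" for l
    using sd that unfolding single_drop_def r a_def by blast+
  have uni: "unimodal ds \<longleftrightarrow> (\<forall>l. 1 \<le> l \<and> l \<le> r \<longrightarrow> a l \<le> a (l + 1))"
    unfolding a_def by (rule unimodal_iff[OF rev L])
  have star: "form_star ds \<longleftrightarrow>
     (unimodal ds \<and> (\<exists>i. 1 \<le> i \<and> i < r \<and> odd (a i) \<and> even (a (i + 1)))) \<or>
     (\<exists>l. 1 \<le> l \<and> l \<le> r \<and> a l > a (l + 1) \<and>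
        (\<exists>i. 1 \<le> i \<and> i < l \<and> odd (a i) \<and> even (a (i + 1)) \<and>
           (i + 1 = l \<longrightarrow> a i < a (l + 1)))) \<or>
     (\<exists>l. 1 \<le> l \<and> l \<le> r \<and> a l > a (l + 1) \<and> odd (a l))"
    using L by (simp add: form_star_def Let_def a_def)
  have bad: "bad_rect ds s \<longleftrightarrow> odd (a s) \<and> even (a (s + 1)) \<and> (a s > a (s + 1) \<or> s < r \<and>
      \<not> (odd (sum_list ds) \<and> a (s + 1) > a (s + 2) \<and> a s = a (s + 2)))" for s
    by (simp only: bad_rect_def a_def r)
  have "block_start ds (r + 1) + blen ds (r + 1) + block_start ds (r + 1) = sum_list ds"
    using block_start_opp[OF rev, of "r + 1"] L by simp
  then have parity: "odd (sum_list ds) \<longleftrightarrow> odd (a (r + 1))"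
    unfolding a_def by presburger
  show ?thesis
  proof
    assume "form_star ds"
    then consider
      (1) i where "unimodal ds" "1 \<le> i" "i < r" "odd (a i)" "even (a (i + 1))"
      | (2) l i where "1 \<le> l" "l \<le> r" "a l > a (l + 1)" "1 \<le> i" "i < l" "odd (a i)" "even (a (i + 1))"
        "i + 1 = l \<longrightarrow> a i < a (l + 1)"
      | (3) l where "1 \<le> l" "l \<le> r" "a l > a (l + 1)" "odd (a l)"
      unfolding star by blast
    then show "\<exists>s\<in>{1..r}. bad_rect ds s"
    proof cases
      case 1
      then have "a (i + 1) \<le> a (i + 1 + 1)" using uni by simp
      then have "bad_rect ds i" using 1 by (simp add: bad)
      then show ?thesis using 1 by auto
    next
      case 2
      \<comment> \<open>The exceptional rectangle cannot occur at \<open>i\<close>: for i + 1 = l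
        its equality contradicts the strict inequality, and otherwise there would be a second drop
        at \<open>l\<close>.\<close>
      have "\<not> (a (i + 1) > a (i + 2) \<and> a i = a (i + 2))"
      proof
        assume h: "a (i + 1) > a (i + 2) \<and> a i = a (i + 2)"
        show False
        proof (cases "i + 1 = l")
          case True
          then show ?thesis using 2 h by auto
        next
          case False
          then show ?thesis using drop(2)[of "i + 1" l] h 2 by simp
        qed
      qed
      then have "bad_rect ds i" using 2 by (auto simp: bad)
      then show ?thesis using 2 by auto
    next
      case 3
      then have "bad_rect ds l" using drop(1)[of l] by (simp add: bad)
      then show ?thesis using 3 by auto
    qed
  next
    assume "\<exists>s\<in>{1..r}. bad_rect ds s"
    then obtain s where s: "1 \<le> s" "s \<le> r" and b: "bad_rect ds s" by auto
    show "form_star ds"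
    proof (cases "a s > a (s + 1)")
      case True
      then show ?thesis unfolding star using s b by (auto simp: bad)
    next
      case no_drop: False
      then have b': "odd (a s)" "even (a (s + 1))" "s < r"
        "\<not> (odd (sum_list ds) \<and> a (s + 1) > a (s + 2) \<and> a s = a (s + 2))"
        using b by (auto simp: bad)
      show ?thesis
      proof (cases "unimodal ds")
        case True
        then show ?thesis unfolding star using s b' by blast
      next
        case False
        then obtain l where l: "1 \<le> l" "l \<le> r" "a l > a (l + 1)" using uni by force
        have "s < l"
        proof (rule ccontr)
          assume "\<not> s < l"
          then have "l < s" using l no_drop by (cases "s = l") auto
          then have "a s = a (s + 1)" using drop(2)[OF l] s by simp
          then show False using b' by simp
        qed
        moreover have "a s < a (l + 1)" if "s + 1 = l"
        proof -
          \<comment> \<open>All blocks from the drop to the centre are equally long, so the parity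
            of N can be read off a_{l+1}.\<close>
          have const: "a (l + 1 + m) = a (l + 1)" if "l + m \<le> r" for m
            using that by (induction m) (use drop(2)[OF l] in auto)
          have "a (r + 1) = a (l + 1)" using const[of "r - l"] l by simp
          moreover have "a s \<noteq> a (s + 1)" using b' by auto
          then have "a s \<le> a (l + 1)" using drop(1)[OF l] no_drop that by auto
          moreover have "a s \<noteq> a (l + 1)"
          proof
            assume "a s = a (l + 1)"
            then show False using b' l that parity \<open>a (r + 1) = a (l + 1)\<close> by auto
          qed
          ultimately show ?thesis by simp
        qed
        ultimately show ?thesis unfolding star using l s b' by blast
      qed
    qed
  qed
qed

section \<open>The criterion evaluated type by type\<close>

lemma blen_pos:
  assumes "block_sequence T ds" "1 \<le> i" "i \<le> length ds"
  shows "0 < blen ds i"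
proof -
  have "0 \<notin> set ds" using assms(1) by (cases T) auto
  moreover have "blen ds i \<in> set ds" using assms(2,3) by (simp add: blen_def)
  ultimately show ?thesis by (metis gr0I)
qed

text \<open>For an odd number of blocks the two J's have total size exactly a_i, so they fit as soon
  as a_i <= a_{i+1}, which niceness provides.\<close>

lemma simple_system_S1_symplectic:
  assumes T: "T = TypeC n" and bs: "block_sequence T ds" and nice: "nice T ds"
  shows "simple_system T (S1 T ds)"
proof -
  have not: "\<not> special_linear T" "\<not> orthogonal_type T" by (auto simp: T special_linear_def)
  have "unique_cols (rect T ds s) \<and> unique_rows (rect T ds s)" if s: "s \<in> {1..length ds div 2}" for s
  proof (cases "even (length ds)")
    case True
    then show ?thesis
      using unique_rect_A unique_J_mat by (simp add: T rect_C_def Let_def)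
  next
    case False
    define a b where "a = blen ds s" and "b = blen ds (s + 1)"
    have "a \<le> b" using nice_symplectic_mono[OF not bs nice, of s] s by (simp add: a_def b_def)
    moreover have "a div 2 + half_up a = a" by (simp add: half_up_def)
    ultimately have c: "unique_cols (corners a b (a div 2) (half_up a))"
      "unique_rows (corners a b (a div 2) (half_up a))"
      "unique_cols (corners a b (half_up a) (a div 2))"
      "unique_rows (corners a b (half_up a) (a div 2))"
      by (auto intro!: unique_rows_corners unique_cols_corners)
    have "rect T ds s = (if odd s then corners a b (a div 2) (half_up a)
        else corners a b (half_up a) (a div 2))"
      using False by (simp add: T rect_C_def Let_def a_def b_def)
    then show ?thesis using c by simp
  qed
  then show ?thesis using not by (simp add: simple_system_S1_iff[OF not(1) bs])
qed

lemma simple_system_S1_orthogonal: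
  assumes T: "orthogonal_type T" and bs: "block_sequence T ds" and nice: "nice T ds"
  shows "simple_system T (S1 T ds) \<longleftrightarrow> \<not> form_star ds"
proof -
  note T' = orthogonal_not_special_linear[OF T]
  have rect: "rect T ds s = rect_BD ds s" for s
    using T by (cases T) auto
  show ?thesis
  proof (cases "even (length ds)")
    case True
    then have "unique_cols (rect T ds s) \<and> unique_rows (rect T ds s)" for s
      using unique_rect_A unique_central_square_BD by (simp add: rect rect_BD_def Let_def)
    moreover have "length ds \<noteq> 2 * s + 1" for s using True by presburger
    ultimately have "simple_system T (S1 T ds)" by (simp add: simple_system_S1_iff[OF T' bs])
    then show ?thesis using True by (simp add: form_star_def)
  next
    case False
    then obtain r where L: "length ds = 2 * r + 1" by (auto elim!: oddE)
    have sd: "single_drop ds"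
      using nice_orthogonal_drop[OF T bs nice False]
      unfolding single_drop_def Suc_eq_plus1[symmetric] by blast
    have "unique_cols (rect_BD ds s) \<and>
        (if length ds = 2 * s + 1 then mirror_rows (rect_BD ds s) else unique_rows (rect_BD ds s)) \<longleftrightarrow>
        \<not> bad_rect ds s" if "s \<in> {1..length ds div 2}" for s
      using that L by (intro rect_BD_simple_iff[OF False] sd blen_pos[OF bs]) auto
    then have "(\<forall>s\<in>{1..length ds div 2}. unique_cols (rect_BD ds s) \<and>
        (if length ds = 2 * s + 1 then mirror_rows (rect_BD ds s) else unique_rows (rect_BD ds s))) \<longleftrightarrow>
        (\<forall>s\<in>{1..length ds div 2}. \<not> bad_rect ds s)"
      by (intro ball_cong refl)
    then have "simple_system T (S1 T ds) \<longleftrightarrow> (\<forall>s\<in>{1..length ds div 2}. \<not> bad_rect ds s)"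
      unfolding simple_system_S1_iff[OF T' bs] rect using T by (simp only: simp_thms)
    moreover have "length ds div 2 = r" using L by simp
    ultimately show ?thesis using form_star_iff_bad_rect[OF block_sequence_rev[OF bs T'] L sd] by (simp only: bex_simps ball_simps simp_thms)
  qed
qed

theorem proposition5p4:
  fixes T :: classical and ds :: "nat list"
  assumes "1 \<le> lie_rank T"
    and "block_sequence T ds"
    and "nice T ds"
  shows "simple_system T (S1 T ds) \<longleftrightarrow>
    (\<exists>n. T = TypeA n \<or> T = TypeC n) \<or> (orthogonal_type T \<and> \<not> form_star ds)"
proof (cases T)
  case (TypeA n)
  have "simple_system T (S1 T ds)"
    by (rule simple_system_S1_special_linear[OF _ assms(2)])
      (auto simp: TypeA special_linear_def unique_rect_A)
  then show ?thesis using TypeA by simp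
next
  case (TypeC n)
  then show ?thesis using simple_system_S1_symplectic[OF TypeC assms(2,3)] by simp
qed (use simple_system_S1_orthogonal[OF _ assms(2,3)] in auto)

end
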